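(* Let $F$ be a field, let $X$ be a small category and let $R\in\mathrm{rep}(X,\mathbf{vect}_F)$. Assume that $F$ has a primitive $n$-th root of unity for some $n$. Then $R$ lies in the additive image of $\mathtt{free}^{\mathrm{pt}}_*\colon\mathrm{rep}(X,\mathbf{Set}^{\mathrm{pt}})\to\mathrm{rep}(X,\mathbf{Vect}_F)$ if $R$ has a basis such that any morphism of $X$ maps any basis vector to a multiple $\lambda$ of a basis vector, where $\lambda$ is either an $n$-th root of unity or $0$.
   Context: For a small category $X$ and a category $C$, $\mathrm{rep}(X,C)$ is the category of functors $X\to C$. $\mathbf{Vect}_F$ (resp. $\mathbf{vect}_F$) is the category of (finite-dimensional) $F$-vector spaces; $\mathbf{Set}^{\mathrm{pt}}$ is the category of pointed sets. A basis of $R$ is a choice of a basis of $R(x)$ for each object $x$; the condition means that for each morphism $x\to y$ and each basis vector $b$ of $R(x)$ one has $R(x\to y)(b)=\lambda b'$ for some basis vector $b'$ of $R(y)$ (or $R(x\to y)(b)=0$), with $\lambda$ (depending on the morphism and $b$) as stated. $\mathtt{free}^{\mathrm{pt}}\colon\mathbf{Set}^{\mathrm{pt}}\to\mathbf{Vect}_F$ sends $(S,* )$ to the free vector space on $S\setminus\{*\}$; a pointed map $f$ is sent to the linear map with $s\mapsto f(s)$ if $f(s)\ne *$ and $s\mapsto 0$ otherwise. $\mathtt{free}^{\mathrm{pt}}_*(S)=\mathtt{free}^{\mathrm{pt}}\circ S$. The additive image of a functor $T\colon A\to B$ with $B$ additive consists of all finite direct sums of direct summands of objects isomorphic to some $T(Z)$,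 $Z\in A$. *)

theory Defs
  imports "Jordan_Normal_Form.Missing_VectorSpace"
begin

section \<open>Small categories\<close>

text \<open>\<open>Comp X g f\<close> is the composite \<open>g \<circ> f\<close>, meaningful when \<open>Cod X f = Dom X g\<close>.\<close>

record ('o, 'a) cat =
  Obj :: "'o set"
  Arr :: "'a set"
  Dom :: "'a \<Rightarrow> 'o"
  Cod :: "'a \<Rightarrow> 'o"
  Id :: "'o \<Rightarrow> 'a"
  Comp :: "'a \<Rightarrow> 'a \<Rightarrow> 'a"

locale small_category =
  fixes X :: "('o, 'a) cat"
  assumes Dom_Obj: "f \<in> Arr X \<Longrightarrow> Dom X f \<in> Obj X"
    and Cod_Obj: "f \<in> Arr X \<Longrightarrow> Cod X f \<in> Obj X"
    and Id_Arr: "x \<in> Obj X \<Longrightarrow> Id X x \<in> Arr X"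
    and Dom_Id: "x \<in> Obj X \<Longrightarrow> Dom X (Id X x) = x"
    and Cod_Id: "x \<in> Obj X \<Longrightarrow> Cod X (Id X x) = x"
    and Comp_Arr: "\<lbrakk>f \<in> Arr X; g \<in> Arr X; Cod X f = Dom X g\<rbrakk> \<Longrightarrow> Comp X g f \<in> Arr X"
    and Dom_Comp: "\<lbrakk>f \<in> Arr X; g \<in> Arr X; Cod X f = Dom X g\<rbrakk> \<Longrightarrow> Dom X (Comp X g f) = Dom X f"
    and Cod_Comp: "\<lbrakk>f \<in> Arr X; g \<in> Arr X; Cod X f = Dom X g\<rbrakk> \<Longrightarrow> Cod X (Comp X g f) = Cod X g"
    and Comp_Id_right: "f \<in> Arr X \<Longrightarrow> Comp X f (Id X (Dom X f)) = f"
    and Comp_Id_left: "f \<in> Arr X \<Longrightarrow> Comp X (Id X (Cod X f)) f = f"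
    and Comp_assoc: "\<lbrakk>f \<in> Arr X; g \<in> Arr X; h \<in> Arr X; Cod X f = Dom X g; Cod X g = Dom X h\<rbrakk>
      \<Longrightarrow> Comp X h (Comp X g f) = Comp X (Comp X h g) f"

section \<open>The categories rep(X, Vect) and rep(X, vect)\<close>

text \<open>Linear maps are functions that matter on the carrier of their source only; hence all
  equations between them are required on carriers.\<close>

record ('o, 'a, 'f, 'v) linrep =
  VS :: "'o \<Rightarrow> ('f, 'v) module"
  act :: "'a \<Rightarrow> 'v \<Rightarrow> 'v"

locale vect_rep =
  fixes X :: "('o, 'a) cat" and F :: "('f, 'r) ring_scheme" and R :: "('o, 'a, 'f, 'v) linrep"
  assumes VS_vectorspace: "x \<in> Obj X \<Longrightarrow> vectorspace F (VS R x)"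
    and act_linear: "f \<in> Arr X \<Longrightarrow> linear_map F (VS R (Dom X f)) (VS R (Cod X f)) (act R f)"
    and act_Id: "\<lbrakk>x \<in> Obj X; v \<in> carrier (VS R x)\<rbrakk> \<Longrightarrow> act R (Id X x) v = v"
    and act_Comp: "\<lbrakk>f \<in> Arr X; g \<in> Arr X; Cod X f = Dom X g; v \<in> carrier (VS R (Dom X f))\<rbrakk>
      \<Longrightarrow> act R (Comp X g f) v = act R g (act R f v)"

locale fd_vect_rep = vect_rep +
  assumes VS_fin_dim: "x \<in> Obj X \<Longrightarrow> vectorspace.fin_dim F (VS R x)"

definition rep_hom ::
  "('o, 'a) cat \<Rightarrow> ('f, 'r) ring_scheme \<Rightarrow> ('o, 'a, 'f, 'v) linrep \<Rightarrow> ('o, 'a, 'f, 'w) linrep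
    \<Rightarrow> ('o \<Rightarrow> 'v \<Rightarrow> 'w) \<Rightarrow> bool" where
  "rep_hom X F R R' \<phi> \<longleftrightarrow>
     (\<forall>x\<in>Obj X. linear_map F (VS R x) (VS R' x) (\<phi> x)) \<and>
     (\<forall>f\<in>Arr X. \<forall>v\<in>carrier (VS R (Dom X f)).
        \<phi> (Cod X f) (act R f v) = act R' f (\<phi> (Dom X f) v))"

definition rep_iso ::
  "('o, 'a) cat \<Rightarrow> ('f, 'r) ring_scheme \<Rightarrow> ('o, 'a, 'f, 'v) linrep \<Rightarrow> ('o, 'a, 'f, 'w) linrep
    \<Rightarrow> bool" where
  "rep_iso X F R R' \<longleftrightarrow>
     (\<exists>\<phi> \<psi>. rep_hom X F R R' \<phi> \<and> rep_hom X F R' R \<psi> \<and>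
        (\<forall>x\<in>Obj X. (\<forall>v\<in>carrier (VS R x). \<psi> x (\<phi> x v) = v) \<and>
                    (\<forall>w\<in>carrier (VS R' x). \<phi> x (\<psi> x w) = w)))"

text \<open>Direct sums are formed objectwise. The fields \<open>mult\<close> and \<open>one\<close> of a module record carry no
  meaning; below they are filled with the zero vector.\<close>

definition rep_direct_sum ::
  "('o, 'a, 'f, 'v) linrep \<Rightarrow> ('o, 'a, 'f, 'w) linrep \<Rightarrow> ('o, 'a, 'f, 'v \<times> 'w) linrep" where
  "rep_direct_sum R R' =
     \<lparr>VS = (\<lambda>x. direct_sum (VS R x) (VS R' x)),
      act = (\<lambda>f (v, w). (act R f v, act R' f w))\<rparr>"

definition fin_direct_sum_vs :: "nat \<Rightarrow> (nat \<Rightarrow> ('f, 'v) module) \<Rightarrow> ('f, nat \<Rightarrow> 'v) module" where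
  "fin_direct_sum_vs k V =
     \<lparr>carrier = (\<Pi>\<^sub>E i\<in>{..<k}. carrier (V i)),
      mult = (\<lambda>u v. \<lambda>i\<in>{..<k}. \<zero>\<^bsub>V i\<^esub>),
      one = (\<lambda>i\<in>{..<k}. \<zero>\<^bsub>V i\<^esub>),
      zero = (\<lambda>i\<in>{..<k}. \<zero>\<^bsub>V i\<^esub>),
      add = (\<lambda>u v. \<lambda>i\<in>{..<k}. u i \<oplus>\<^bsub>V i\<^esub> v i),
      smult = (\<lambda>c v. \<lambda>i\<in>{..<k}. c \<odot>\<^bsub>V i\<^esub> v i)\<rparr>"

definition rep_fin_direct_sum ::
  "nat \<Rightarrow> (nat \<Rightarrow> ('o, 'a, 'f, 'v) linrep) \<Rightarrow> ('o, 'a, 'f, nat \<Rightarrow> 'v) linrep" where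
  "rep_fin_direct_sum k D =
     \<lparr>VS = (\<lambda>x. fin_direct_sum_vs k (\<lambda>i. VS (D i) x)),
      act = (\<lambda>f v. \<lambda>i\<in>{..<k}. act (D i) f (v i))\<rparr>"

text \<open>The complement \<open>C\<close> ranges over representations with vectors of the same type as those of
  \<open>E\<close>. This is no restriction, since a complement is isomorphic to a subrepresentation of \<open>E\<close>.\<close>

definition direct_summand ::
  "('o, 'a) cat \<Rightarrow> ('f, 'r) ring_scheme \<Rightarrow> ('o, 'a, 'f, 'v) linrep \<Rightarrow> ('o, 'a, 'f, 'w) linrep
    \<Rightarrow> bool" where
  "direct_summand X F D E \<longleftrightarrow>
     vect_rep X F D \<and>
     (\<exists>C :: ('o, 'a, 'f, 'w) linrep. vect_rep X F C \<and> rep_iso X F E (rep_direct_sum D C))"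

section \<open>The category rep(X, pointed sets)\<close>

record ('o, 'a, 's) ptrep =
  pset :: "'o \<Rightarrow> 's set"
  pt :: "'o \<Rightarrow> 's"
  pmap :: "'a \<Rightarrow> 's \<Rightarrow> 's"

locale pointed_rep =
  fixes X :: "('o, 'a) cat" and S :: "('o, 'a, 's) ptrep"
  assumes pt_in: "x \<in> Obj X \<Longrightarrow> pt S x \<in> pset S x"
    and pmap_in: "\<lbrakk>f \<in> Arr X; s \<in> pset S (Dom X f)\<rbrakk> \<Longrightarrow> pmap S f s \<in> pset S (Cod X f)"
    and pmap_pt: "f \<in> Arr X \<Longrightarrow> pmap S f (pt S (Dom X f)) = pt S (Cod X f)"
    and pmap_Id: "\<lbrakk>x \<in> Obj X; s \<in> pset S x\<rbrakk> \<Longrightarrow> pmap S (Id X x) s = s"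
    and pmap_Comp: "\<lbrakk>f \<in> Arr X; g \<in> Arr X; Cod X f = Dom X g; s \<in> pset S (Dom X f)\<rbrakk>
      \<Longrightarrow> pmap S (Comp X g f) s = pmap S g (pmap S f s)"

section \<open>Free vector spaces on pointed sets\<close>

text \<open>The free vector space on \<open>A - {p}\<close>: finitely supported coefficient functions.\<close>

definition free_pt :: "('f, 'r) ring_scheme \<Rightarrow> 's set \<Rightarrow> 's \<Rightarrow> ('f, 's \<Rightarrow> 'f) module" where
  "free_pt F A p =
     \<lparr>carrier = {c. (\<forall>s. c s \<in> carrier F) \<and> finite {s. c s \<noteq> \<zero>\<^bsub>F\<^esub>} \<and>
                    {s. c s \<noteq> \<zero>\<^bsub>F\<^esub>} \<subseteq> A - {p}},
      mult = (\<lambda>c d s. \<zero>\<^bsub>F\<^esub>),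
      one = (\<lambda>s. \<zero>\<^bsub>F\<^esub>),
      zero = (\<lambda>s. \<zero>\<^bsub>F\<^esub>),
      add = (\<lambda>c d s. c s \<oplus>\<^bsub>F\<^esub> d s),
      smult = (\<lambda>a c s. a \<otimes>\<^bsub>F\<^esub> c s)\<rparr>"

text \<open>The linear map induced by a pointed map \<open>h\<close> with target base point \<open>q\<close>: the coefficient of the
  image of \<open>c\<close> at \<open>t \<noteq> q\<close> is the sum of \<open>c\<close> over the fibre of \<open>h\<close> at \<open>t\<close>. Its values on generators
  are computed in \<open>free_pt_map_gen\<close> below.\<close>

definition free_pt_map ::
  "('f, 'r) ring_scheme \<Rightarrow> 't \<Rightarrow> ('s \<Rightarrow> 't) \<Rightarrow> ('s \<Rightarrow> 'f) \<Rightarrow> ('t \<Rightarrow> 'f)" where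
  "free_pt_map F q h c =
     (\<lambda>t. if t = q then \<zero>\<^bsub>F\<^esub> else (\<Oplus>\<^bsub>F\<^esub>s\<in>{s. c s \<noteq> \<zero>\<^bsub>F\<^esub> \<and> h s = t}. c s))"

lemma (in field) free_pt_map_gen:
  "free_pt_map R q h (\<lambda>s'. if s' = s then \<one> else \<zero>) =
     (if h s = q then (\<lambda>t. \<zero>) else (\<lambda>t. if t = h s then \<one> else \<zero>))"
proof -
  have "{s'. (if s' = s then \<one> else \<zero>) \<noteq> \<zero> \<and> h s' = t} = (if h s = t then {s} else {})" for t
    by auto
  then show ?thesis
    by (auto simp: free_pt_map_def fun_eq_iff)
qed

definition free_pt_star ::
  "('o, 'a) cat \<Rightarrow> ('f, 'r) ring_scheme \<Rightarrow> ('o, 'a, 's) ptrep \<Rightarrow> ('o, 'a, 'f, 's \<Rightarrow> 'f) linrep" where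
  "free_pt_star X F S =
     \<lparr>VS = (\<lambda>x. free_pt F (pset S x) (pt S x)),
      act = (\<lambda>f. free_pt_map F (pt S (Cod X f)) (pmap S f))\<rparr>"

section \<open>Additive images\<close>

text \<open>Additive image of a functor with values in \<open>rep(X, Vect)\<close>; \<open>A\<close> is the class of objects of the
  source and \<open>T\<close> the object part. That the \<open>E i\<close> have the vector type of the \<open>T (Z i)\<close> and the \<open>D i\<close>
  that of \<open>R\<close> is no restriction: the former are isomorphic to the \<open>T (Z i)\<close>, and the latter are
  isomorphic to subrepresentations of \<open>R\<close>.\<close>

definition additive_image ::
  "('o, 'a) cat \<Rightarrow> ('f, 'r) ring_scheme \<Rightarrow> 'z set \<Rightarrow> ('z \<Rightarrow> ('o, 'a, 'f, 'w) linrep)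
    \<Rightarrow> ('o, 'a, 'f, 'v) linrep set" where
  "additive_image X F A T =
     {R. vect_rep X F R \<and>
         (\<exists>k Z (E :: nat \<Rightarrow> ('o, 'a, 'f, 'w) linrep) (D :: nat \<Rightarrow> ('o, 'a, 'f, 'v) linrep).
            (\<forall>i<k. Z i \<in> A \<and> vect_rep X F (E i) \<and> rep_iso X F (E i) (T (Z i)) \<and>
                   direct_summand X F (D i) (E i)) \<and>
            rep_iso X F R (rep_fin_direct_sum k D))}"

text \<open>Every pointed set has to live in some type. For \<open>R\<close> with arrows of type \<open>'a\<close> and vectors of
  type \<open>'v\<close>, the type \<open>'a \<times> 'v \<times> nat\<close> is large enough to give the additive image in the
  unrestricted sense: if \<open>R\<close> is a direct sum of summands \<open>D i\<close> of \<open>free_pt_star X F (S i)\<close> with \<open>S i\<close>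
  arbitrary, then \<open>D i\<close> is also a summand of the free representation on the subfunctor of \<open>S i\<close>
  generated by the supports of the images of the vectors of \<open>D i\<close>, and at each object that subfunctor
  has at most (arrows) x (vectors) x (countably many) elements.\<close>

definition free_pt_additive_image ::
  "('o, 'a) cat \<Rightarrow> ('f, 'r) ring_scheme \<Rightarrow> ('o, 'a, 'f, 'v) linrep set" where
  "free_pt_additive_image X F =
     additive_image X F {S :: ('o, 'a, 'a \<times> 'v \<times> nat) ptrep. pointed_rep X S} (free_pt_star X F)"

section \<open>Roots of unity\<close>

definition primitive_root_of_unity :: "('f, 'r) ring_scheme \<Rightarrow> nat \<Rightarrow> 'f \<Rightarrow> bool" where
  "primitive_root_of_unity F n z \<longleftrightarrow>
     0 < n \<and> z \<in> carrier F \<and> z [^]\<^bsub>F\<^esub> n = \<one>\<^bsub>F\<^esub> \<and>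
     (\<forall>m. 0 < m \<and> m < n \<longrightarrow> z [^]\<^bsub>F\<^esub> m \<noteq> \<one>\<^bsub>F\<^esub>)"

end

theory Submission
  imports Defs "HOL-Algebra.Polynomial_Divisibility"
begin

text \<open>The sets \<open>S(x)\<close> of all vectors \<open>\<zeta> b\<close> with \<open>\<zeta>\<^sup>n = 1\<close> and \<open>b\<close> a basis vector of \<open>R(x)\<close>, together with
  the base point \<open>0\<close>, are preserved by all morphisms and form a pointed subfunctor of \<open>R\<close>. The
  inclusion extends linearly to \<open>\<pi>: free(S) \<rightarrow> R\<close>. Since \<open>n\<close> is invertible in \<open>F\<close>, one can average: the
  map \<open>\<iota>\<close> that sends a basis vector \<open>b\<close> to \<open>n\<^sup>-\<^sup>1 \<Sum> \<zeta>\<^sup>-\<^sup>1 [\<zeta> b]\<close>, the sum being over the \<open>n\<close>-th roots of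
  unity, turns multiplication by a root of unity on \<open>S\<close> into scalar multiplication, hence is natural,
  and it satisfies \<open>\<pi> \<circ> \<iota> = id\<close>. So \<open>R\<close> is the complement of \<open>ker \<pi>\<close> in \<open>free(S)\<close>.\<close>

text \<open>The indeterminate of the polynomial library would otherwise capture the category \<open>X\<close>.\<close>

no_notation var (\<open>X\<index>\<close>)

section \<open>Linear maps\<close>

text \<open>The obstacle is naturality. The obvious linear section of \<pi>, which sends b to the
  generator [b], is not natural: if a morphism takes b to \<lambda> b', it takes [b] to
  [\<lambda> b'], while linearity demands \<lambda> [b'], and these differ in free(S) unless
  \<lambda> is 0 or 1. The weights in \<iota> are forced: if w is the coefficient function of a
  combination of the [\<zeta> b] on which the shift [\<zeta> b] to [\<zeta> \<xi> b] acts as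
  multiplication by \<xi>, then w(\<zeta>) is the inverse of \<zeta> times w(1). Applying \<pi> to
  the sum with w(1) = 1 gives one copy of b for each root of unity, so the remaining scalar must be
  the inverse of their number. The primitive root therefore enters twice: it makes that number
  exactly n, and it keeps n from vanishing in F.\<close>

lemma linear_mapI:
  assumes "vectorspace K V" and "vectorspace K W"
    and "\<And>v. v \<in> carrier V \<Longrightarrow> T v \<in> carrier W"
    and "\<And>u v. \<lbrakk>u \<in> carrier V; v \<in> carrier V\<rbrakk> \<Longrightarrow> T (u \<oplus>\<^bsub>V\<^esub> v) = T u \<oplus>\<^bsub>W\<^esub> T v"
    and "\<And>c v. \<lbrakk>c \<in> carrier K; v \<in> carrier V\<rbrakk> \<Longrightarrow> T (c \<odot>\<^bsub>V\<^esub> v) = c \<odot>\<^bsub>W\<^esub> T v"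
  shows "linear_map K V W T"
proof -
  interpret V: vectorspace K V by fact
  interpret W: vectorspace K W by fact
  show ?thesis
    by unfold_locales (simp add: LinearCombinations.module_hom_def assms(3-5))
qed

lemma linear_map_id:
  assumes "vectorspace K V"
  shows "linear_map K V V (\<lambda>v. v)"
  using assms by (intro linear_mapI) auto

lemma linear_map_comp:
  assumes "linear_map K U V S" and "linear_map K V W T"
  shows "linear_map K U W (\<lambda>u. T (S u))"
proof -
  interpret S: linear_map K U V S by fact
  interpret T: linear_map K V W T by fact
  show ?thesis
    by (intro linear_mapI S.V.vectorspace_axioms T.W.vectorspace_axioms) auto
qed

lemma linear_map_cong:
  assumes "linear_map K V W S" and "\<And>v. v \<in> carrier V \<Longrightarrow> T v = S v"
  shows "linear_map K V W T"
proof -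
  interpret linear_map K V W S by fact
  show ?thesis
    by (intro linear_mapI V.vectorspace_axioms W.vectorspace_axioms) (simp_all add: assms(2))
qed

lemma linear_map_minus:
  assumes "linear_map K V W S" and "linear_map K V W T"
  shows "linear_map K V W (\<lambda>v. S v \<ominus>\<^bsub>W\<^esub> T v)"
proof -
  interpret W: vectorspace K W
    using assms(1) by (simp add: linear_map_def)
  interpret S: linear_map K V W S by fact
  note T = linear_map.T_im[OF assms(2)] linear_map.T_add[OF assms(2)] linear_map.T_smult[OF assms(2)]
  show ?thesis
  proof (intro linear_mapI S.V.vectorspace_axioms W.vectorspace_axioms)
    fix u v assume u: "u \<in> carrier V" and v: "v \<in> carrier V"
    then show "S (u \<oplus>\<^bsub>V\<^esub> v) \<ominus>\<^bsub>W\<^esub> T (u \<oplus>\<^bsub>V\<^esub> v) = (S u \<ominus>\<^bsub>W\<^esub> T u) \<oplus>\<^bsub>W\<^esub> (S v \<ominus>\<^bsub>W\<^esub> T v)"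
      by (simp add: T W.minus_eq W.minus_add W.a_ac)
  next
    fix a v assume "a \<in> carrier K" and "v \<in> carrier V"
    then show "S (a \<odot>\<^bsub>V\<^esub> v) \<ominus>\<^bsub>W\<^esub> T (a \<odot>\<^bsub>V\<^esub> v) = a \<odot>\<^bsub>W\<^esub> (S v \<ominus>\<^bsub>W\<^esub> T v)"
      by (simp add: T W.minus_eq W.smult_r_distr W.smult_r_minus)
  qed (simp add: T)
qed

lemma linear_map_direct_sum:
  assumes "linear_map K U V S" and "linear_map K U W T"
  shows "linear_map K U (direct_sum V W) (\<lambda>u. (S u, T u))"
proof -
  interpret S: linear_map K U V S by fact
  interpret T: linear_map K U W T by fact
  show ?thesis
    by (rule linear_mapI[OF S.V.vectorspace_axioms
          direct_sum_is_vs[OF S.W.vectorspace_axioms T.W.vectorspace_axioms]])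
      (simp_all add: direct_sum_def)
qed

lemma linear_map_into_subspace:
  assumes "linear_map K V W T" and "vectorspace K (W\<lparr>carrier := U\<rparr>)"
    and "\<And>v. v \<in> carrier V \<Longrightarrow> T v \<in> U"
  shows "linear_map K V (W\<lparr>carrier := U\<rparr>) T"
proof -
  interpret T: linear_map K V W T by fact
  show ?thesis
    by (rule linear_mapI[OF T.V.vectorspace_axioms assms(2)]) (simp_all add: assms(3))
qed

lemma linear_map_finsum:
  assumes "linear_map K V W T" and "g \<in> A \<rightarrow> carrier V"
  shows "T (finsum V g A) = finsum W (\<lambda>a. T (g a)) A"
proof -
  interpret linear_map K V W T by fact
  show ?thesis
    using assms(2)
  \<comment> \<open>Over an infinite index set \<open>finsum\<close> is zero by convention, and
    \<open>T\<close> preserves zero, so the equation holds there too.\<close>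
  proof (induct A rule: infinite_finite_induct)
    case (insert a A)
    then have "(\<lambda>a. T (g a)) \<in> insert a A \<rightarrow> carrier W"
      by auto
    with insert show ?case
      by (simp add: Pi_def)
  qed simp_all
qed

text \<open>Every vector is a finite combination of elements of \<open>B\<close>, and linear maps
  commute with such combinations. Naturality of \<iota> and the retraction identity are checked on
  basis vectors through this lemma.\<close>

lemma linear_map_eq_on_basis:
  assumes "linear_map K V W S" and "linear_map K V W T"
    and "vectorspace.basis K V B" and "\<And>b. b \<in> B \<Longrightarrow> S b = T b"
    and "v \<in> carrier V"
  shows "S v = T v"
proof -
  interpret V: vectorspace K V
    using assms(1) by (simp add: linear_map_def)
  interpret W: vectorspace K W
    using assms(1) by (simp add: linear_map_def)
  note S = linear_map.T_smult[OF assms(1)] and T = linear_map.T_smult[OF assms(2)]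
  from assms(3) have gen: "V.span B = carrier V" and B: "B \<subseteq> carrier V"
    by (auto simp: V.basis_def)
  have "v \<in> V.span B"
    by (simp add: gen assms(5))
  then obtain a A where A: "finite A" "A \<subseteq> B" "a \<in> A \<rightarrow> carrier K"
    and v: "v = V.lincomb a A"
    unfolding V.span_def by blast
  have Pi: "(\<lambda>b. a b \<odot>\<^bsub>V\<^esub> b) \<in> A \<rightarrow> carrier V"
    using A B by auto
  have "S v = finsum W (\<lambda>b. S (a b \<odot>\<^bsub>V\<^esub> b)) A"
    unfolding v V.lincomb_def by (rule linear_map_finsum[OF assms(1) Pi])
  also have "\<dots> = finsum W (\<lambda>b. T (a b \<odot>\<^bsub>V\<^esub> b)) A"
  proof (rule W.finsum_cong')
    show "(\<lambda>b. T (a b \<odot>\<^bsub>V\<^esub> b)) \<in> A \<rightarrow> carrier W"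
      using Pi linear_map.T_im[OF assms(2)] by blast
    show "S (a b \<odot>\<^bsub>V\<^esub> b) = T (a b \<odot>\<^bsub>V\<^esub> b)" if "b \<in> A" for b
    proof -
      have "a b \<in> carrier K" "b \<in> carrier V"
        using that A B by auto
      then show ?thesis
        using S T assms(4)[of b] that A by auto
    qed
  qed simp
  also have "\<dots> = T v"
    unfolding v V.lincomb_def by (rule linear_map_finsum[OF assms(2) Pi, symmetric])
  finally show ?thesis .
qed

text \<open>Coordinates with respect to \<open>B\<close> depend linearly on the vector, hence so
  does the combination of the \<open>g b\<close> with these coordinates. With the averaged
  generators as \<open>g\<close> this produces \<iota>; the finite bases come from the finite
  dimension of \<open>R\<close>.\<close>

lemma linear_map_extend_basis:
  assumes "vectorspace K V" and "vectorspace K W"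
    and "vectorspace.basis K V B" and "finite B" and "g \<in> B \<rightarrow> carrier W"
  shows "\<exists>T. linear_map K V W T \<and> (\<forall>b\<in>B. T b = g b)"
proof -
  interpret V: vectorspace K V by fact
  interpret W: vectorspace K W by fact
  have B: "B \<subseteq> carrier V"
    using assms(3) by (simp add: V.basis_def)
  have ex1: "\<exists>!a. a \<in> B \<rightarrow>\<^sub>E carrier K \<and> V.lincomb a B = v" if "v \<in> carrier V" for v
    using V.basis_criterion[OF assms(4) B] assms(3) that by simp
  \<comment> \<open>\<open>ex1\<close> ranges over functions that are \<open>undefined\<close>
    outside \<open>B\<close>; this makes the coordinate function unique as a function, so the
    description is well defined.\<close>
  define crd where "crd v = (THE a. a \<in> B \<rightarrow>\<^sub>E carrier K \<and> V.lincomb a B = v)" for v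
  have crd: "crd v \<in> B \<rightarrow>\<^sub>E carrier K \<and> V.lincomb (crd v) B = v" if "v \<in> carrier V" for v
    unfolding crd_def using theI'[OF ex1[OF that]] .
  \<comment> \<open>Coordinates can be read off from any coefficient function representing
    \<open>v\<close>, extensional or not. Additivity, homogeneity and the values on \<open>B\<close>
    all follow by exhibiting such a function.\<close>
  have crdI: "crd v b = a b" if "a \<in> B \<rightarrow> carrier K" "V.lincomb a B = v" "b \<in> B" for v a b
  proof -
    have v: "v \<in> carrier V"
      using that B by auto
    have "V.lincomb (restrict a B) B = v"
      unfolding that(2)[symmetric] by (rule V.lincomb_cong) (use that B in auto)
    with that(1) have "crd v = restrict a B"
      unfolding crd_def by (intro the1_equality[OF ex1[OF v]]) auto
    from fun_cong[OF this, of b] that(3) show ?thesis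
      by simp
  qed
  have crd_closed: "crd v b \<in> carrier K" if "v \<in> carrier V" "b \<in> B" for v b
    using crd[OF that(1)] that(2) by auto
  define T where "T v = finsum W (\<lambda>b. crd v b \<odot>\<^bsub>W\<^esub> g b) B" for v
  have g: "g b \<in> carrier W" if "b \<in> B" for b
    using that assms(5) by auto
  have "linear_map K V W T"
  proof (rule linear_mapI[OF assms(1,2)])
    show "T v \<in> carrier W" if "v \<in> carrier V" for v
      unfolding T_def using that g crd_closed by (intro W.finsum_closed) auto
    show "T (u \<oplus>\<^bsub>V\<^esub> v) = T u \<oplus>\<^bsub>W\<^esub> T v" if u: "u \<in> carrier V" and v: "v \<in> carrier V" for u v
    proof -
      have "V.lincomb (\<lambda>b. crd u b \<oplus>\<^bsub>K\<^esub> crd v b) B = V.lincomb (crd u) B \<oplus>\<^bsub>V\<^esub> V.lincomb (crd v) B"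
        by (rule V.lincomb_sum) (use assms(4) B crd u v in auto)
      then have "crd (u \<oplus>\<^bsub>V\<^esub> v) b = crd u b \<oplus>\<^bsub>K\<^esub> crd v b" if "b \<in> B" for b
        by (intro crdI) (use that crd crd_closed u v in auto)
      then have "T (u \<oplus>\<^bsub>V\<^esub> v) = finsum W (\<lambda>b. crd u b \<odot>\<^bsub>W\<^esub> g b \<oplus>\<^bsub>W\<^esub> crd v b \<odot>\<^bsub>W\<^esub> g b) B"
        unfolding T_def
        by (intro W.finsum_cong') (use g crd_closed u v in \<open>auto simp: W.smult_l_distr\<close>)
      also have "\<dots> = T u \<oplus>\<^bsub>W\<^esub> T v"
        unfolding T_def by (rule W.finsum_addf) (use g crd_closed u v in auto)
      finally show ?thesis .
    qed
    show "T (c \<odot>\<^bsub>V\<^esub> v) = c \<odot>\<^bsub>W\<^esub> T v" if c: "c \<in> carrier K" and v: "v \<in> carrier V" for c v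
    proof -
      have "V.lincomb (\<lambda>b. c \<otimes>\<^bsub>K\<^esub> crd v b) B = c \<odot>\<^bsub>V\<^esub> V.lincomb (crd v) B"
        by (rule V.lincomb_smult) (use B crd c v in auto)
      then have "crd (c \<odot>\<^bsub>V\<^esub> v) b = c \<otimes>\<^bsub>K\<^esub> crd v b" if "b \<in> B" for b
        by (intro crdI) (use that crd crd_closed c v in auto)
      then have "T (c \<odot>\<^bsub>V\<^esub> v) = finsum W (\<lambda>b. c \<odot>\<^bsub>W\<^esub> (crd v b \<odot>\<^bsub>W\<^esub> g b)) B"
        unfolding T_def
        by (intro W.finsum_cong') (use g crd_closed c v in \<open>auto simp: W.smult_assoc1\<close>)
      also have "\<dots> = c \<odot>\<^bsub>W\<^esub> T v"
        unfolding T_def by (rule W.finsum_smult[symmetric]) (use g crd_closed c v in auto)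
      finally show ?thesis .
    qed
  qed
  moreover have "T b = g b" if b: "b \<in> B" for b
  proof -
    let ?d = "\<lambda>b'. if b' = b then \<one>\<^bsub>K\<^esub> else \<zero>\<^bsub>K\<^esub>"
    have "V.lincomb ?d B = finsum V (\<lambda>b'. if b = b' then b' else \<zero>\<^bsub>V\<^esub>) B"
      unfolding V.lincomb_def by (rule V.finsum_cong') (use B in auto)
    also have "\<dots> = b"
      by (rule V.finsum_singleton) (use B b assms(4) in auto)
    finally have "crd b b' = ?d b'" if "b' \<in> B" for b'
      by (intro crdI) (use that in auto)
    then have "T b = finsum W (\<lambda>b'. if b = b' then g b' else \<zero>\<^bsub>W\<^esub>) B"
      unfolding T_def by (intro W.finsum_cong') (use g in auto)
    also have "\<dots> = g b"
      by (rule W.finsum_singleton) (use g b assms(4) in auto)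
    finally show ?thesis .
  qed
  ultimately show ?thesis
    by blast
qed

section \<open>Roots of unity\<close>

text \<open>The multiset \<open>roots p\<close> has size at most the degree, and forgetting
  multiplicities only lowers the count; \<open>A\<close> lies in its support.\<close>

lemma (in field) card_roots_le:
  assumes "set p \<subseteq> carrier R" and "p \<noteq> []" and "lead_coeff p \<noteq> \<zero>"
    and "A \<subseteq> carrier R" and "\<And>a. a \<in> A \<Longrightarrow> eval p a = \<zero>"
  shows "finite A \<and> card A \<le> degree p"
proof -
  have p: "p \<in> carrier (poly_ring R)"
    using assms by (simp add: univ_poly_carrier[symmetric] polynomial_def)
  have A: "A \<subseteq> set_mset (roots p)"
    using assms roots_mem_iff_is_root[OF p] by (auto simp: is_root_def)
  moreover have "card (set_mset (roots p)) \<le> degree p"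
    using size_roots_le_degree[OF p] size_multiset_overloaded_eq[of "roots p"]
      sum_mono[of "set_mset (roots p)" "\<lambda>_. 1" "count (roots p)"] by (simp add: Suc_leI)
  ultimately show ?thesis
    using finite_subset[OF A] card_mono[OF _ A] by simp
qed

text \<open>Polynomials are coefficient lists with the leading coefficient first, so
  \<open>replicate n \<one>\<close> is 1 + X + ... + X^(n-1), and this is the geometric sum with the
  denominator cleared.\<close>

lemma (in cring) eval_replicate_one:
  assumes "x \<in> carrier R"
  shows "(x \<ominus> \<one>) \<otimes> eval (replicate n \<one>) x = x [^] n \<ominus> \<one>"
proof (induct n)
  case (Suc n)
  have e: "eval (replicate n \<one>) x \<in> carrier R"
    using assms by (intro eval_in_carrier) auto
  have "(x \<ominus> \<one>) \<otimes> eval (replicate (Suc n) \<one>) x = (x \<ominus> \<one>) \<otimes> x [^] n \<oplus> (x \<ominus> \<one>) \<otimes> eval (replicate n \<one>) x"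
    using assms e by (simp add: r_distr)
  also have "\<dots> = (x \<ominus> \<one>) \<otimes> x [^] n \<oplus> (x [^] n \<ominus> \<one>)"
    by (simp only: Suc)
  also have "\<dots> = x [^] n \<otimes> x \<ominus> \<one>"
  proof -
    have "x [^] n \<in> carrier R"
      using assms by simp
    then show ?thesis
      using assms by algebra
  qed
  finally show ?case
    using assms by simp
qed (simp add: assms minus_eq r_neg)

text \<open>The geometric sum formula says nothing at 1. This value decides whether 1 is a root:
  exactly when n vanishes in the ring.\<close>

lemma (in ring) eval_replicate_one_at_one:
  "eval (replicate n \<one>) \<one> = [n] \<cdot> \<one>"
  by (induct n) (simp_all add: add.m_comm)

text \<open>Every \<open>n\<close>-th root of unity other than \<open>1\<close> is a root of \<open>1 + X + \<dots> + X\<^sup>n\<^sup>-\<^sup>1\<close>. If \<open>n = 0\<close> in the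
  field, then \<open>1\<close> is one as well, and there are too many roots.\<close>

lemma (in field) roots_of_unity:
  assumes "primitive_root_of_unity R n z"
  shows "finite {a \<in> carrier R. a [^] n = \<one>}"
    and "card {a \<in> carrier R. a [^] n = \<one>} = n"
    and "[n] \<cdot> \<one> \<noteq> \<zero>"
proof -
  let ?\<mu> = "{a \<in> carrier R. a [^] n = \<one>}"
  let ?p = "replicate n \<one>"
  from assms have n: "0 < n" and z: "z \<in> carrier R" "z [^] n = \<one>"
    and prim: "\<And>m. \<lbrakk>0 < m; m < n\<rbrakk> \<Longrightarrow> z [^] m \<noteq> \<one>"
    by (auto simp: primitive_root_of_unity_def)
  have root: "eval ?p a = \<zero>" if "a \<in> ?\<mu>" "a \<noteq> \<one>" for a
  proof -
    have "(a \<ominus> \<one>) \<otimes> eval ?p a = \<zero>"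
      using eval_replicate_one[of a n] that by (simp add: r_neg minus_eq)
    moreover have "eval ?p a \<in> carrier R"
      using that by (intro eval_in_carrier) auto
    ultimately show ?thesis
      using that integral_iff[of "a \<ominus> \<one>" "eval ?p a"] by auto
  qed
  have bound: "finite A \<and> card A \<le> n - 1" if "A \<subseteq> ?\<mu>" "\<And>a. a \<in> A \<Longrightarrow> eval ?p a = \<zero>" for A
    using card_roots_le[of ?p A] that n by auto
  \<comment> \<open>\<open>bound\<close> is applied twice. Here 1 is left out, which gives at most n
    roots of unity in all; in the final contradiction 1 is included, which would give at most n -
    1.\<close>
  have "finite (?\<mu> - {\<one>}) \<and> card (?\<mu> - {\<one>}) \<le> n - 1"
    using root by (intro bound) auto
  then have fin: "finite ?\<mu>" and le: "card ?\<mu> \<le> n"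
    using n by (auto simp: card_Diff_singleton_if split: if_splits)
  \<comment> \<open>Since z^i is a factor of z^n = 1 it is nonzero and can be cancelled; equal
    powers i < j would give z^(j-i) = 1 with 0 < j-i < n, against primitivity. Hence there are at
    least n roots of unity.\<close>
  have inj: "inj_on (\<lambda>k. z [^] k) {..<n}"
  proof (rule linorder_inj_onI)
    fix i j :: nat
    assume ij: "i < j" "i \<in> {..<n}" "j \<in> {..<n}"
    have "z [^] j = z [^] (j - i) \<otimes> z [^] i"
      using ij z by (simp add: nat_pow_mult)
    moreover have "z [^] i \<noteq> \<zero>"
    proof
      assume "z [^] i = \<zero>"
      then have "z [^] (i + (n - i)) = \<zero>"
        using z by (simp add: nat_pow_mult[symmetric])
      moreover have "i + (n - i) = n"
        using ij by simp
      ultimately show False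
        by (simp add: z)
    qed
    moreover have "z [^] (j - i) \<noteq> \<one>"
      using ij by (intro prim) auto
    ultimately show "z [^] i \<noteq> z [^] j"
      using m_rcancel[of "z [^] i" "z [^] (j - i)" \<one>] z by auto
  qed auto
  have sub: "(\<lambda>k. z [^] k) ` {..<n} \<subseteq> ?\<mu>"
  proof (clarsimp simp: z)
    fix k :: nat
    have "(z [^] k) [^] n = (z [^] n) [^] k"
      using nat_pow_pow[OF z(1), of k n] nat_pow_pow[OF z(1), of n k] by (simp add: mult.commute)
    then show "(z [^] k) [^] n = \<one>"
      by (simp only: z nat_pow_one)
  qed
  have ge: "n \<le> card ?\<mu>"
    using card_mono[OF fin sub] card_image[OF inj] by simp
  show "finite ?\<mu>" "card ?\<mu> = n"
    using fin le ge by auto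
  show "[n] \<cdot> \<one> \<noteq> \<zero>"
  proof
    assume "[n] \<cdot> \<one> = \<zero>"
    then have "eval ?p a = \<zero>" if "a \<in> ?\<mu>" for a
      using root[OF that] eval_replicate_one_at_one[of n] by (cases "a = \<one>") auto
    then have "card ?\<mu> \<le> n - 1"
      using bound[of ?\<mu>] by blast
    with ge n show False
      by simp
  qed
qed

definition unity_roots :: "('f, 'r) ring_scheme \<Rightarrow> nat \<Rightarrow> 'f set" where
  "unity_roots F n = {a \<in> carrier F. a [^]\<^bsub>F\<^esub> n = \<one>\<^bsub>F\<^esub>}"

context field
begin

lemma inv_nonzero:
  assumes "a \<in> carrier R" and "a \<noteq> \<zero>"
  shows "inv a \<in> carrier R" and "a \<otimes> inv a = \<one>" and "inv a \<otimes> a = \<one>"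
  using assms field_Units by auto

lemma unity_roots_carrier: "a \<in> unity_roots R n \<Longrightarrow> a \<in> carrier R"
  by (simp add: unity_roots_def)

lemma unity_roots_mult:
  "\<lbrakk>a \<in> unity_roots R n; b \<in> unity_roots R n\<rbrakk> \<Longrightarrow> a \<otimes> b \<in> unity_roots R n"
  by (simp add: unity_roots_def nat_pow_distrib)

lemma unity_roots_nonzero:
  assumes "0 < n" and "a \<in> unity_roots R n"
  shows "a \<noteq> \<zero>"
  using assms by (auto simp: unity_roots_def nat_pow_zero)

lemma unity_roots_inv:
  assumes "0 < n" and "a \<in> unity_roots R n"
  shows "inv a \<in> unity_roots R n"
proof -
  note a = unity_roots_carrier[OF assms(2)] inv_nonzero[OF unity_roots_carrier[OF assms(2)]
      unity_roots_nonzero[OF assms]]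
  have "(a \<otimes> inv a) [^] n = a [^] n \<otimes> inv a [^] n"
    by (rule nat_pow_distrib[OF a(1,2)])
  with assms(2) have "inv a [^] n = \<one>"
    using a by (simp add: unity_roots_def)
  with a show ?thesis
    by (simp add: unity_roots_def)
qed

end

section \<open>Free vector spaces on pointed sets\<close>

text \<open>The generator at the base point is set to zero, so that a pointed map sends generators
  to generators without a case distinction (\<open>free_pt_map_pt_gen\<close>).\<close>

definition pt_gen :: "('f, 'r) ring_scheme \<Rightarrow> 's \<Rightarrow> 's \<Rightarrow> 's \<Rightarrow> 'f" where
  "pt_gen F p s = (\<lambda>t. if t = s \<and> s \<noteq> p then \<one>\<^bsub>F\<^esub> else \<zero>\<^bsub>F\<^esub>)"

text \<open>The linear extension of \<open>g\<close> given by the universal property of the free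
  space; the sum over the support is finite for vectors of \<open>free_pt\<close>.\<close>

definition free_lift ::
  "('f, 'r) ring_scheme \<Rightarrow> ('f, 'w) module \<Rightarrow> ('s \<Rightarrow> 'w) \<Rightarrow> ('s \<Rightarrow> 'f) \<Rightarrow> 'w" where
  "free_lift F W g c = (\<Oplus>\<^bsub>W\<^esub>s\<in>{s. c s \<noteq> \<zero>\<^bsub>F\<^esub>}. c s \<odot>\<^bsub>W\<^esub> g s)"

context field
begin

lemma free_pt_carrier:
  "c \<in> carrier (free_pt R A p) \<longleftrightarrow>
     (\<forall>s. c s \<in> carrier R) \<and> finite {s. c s \<noteq> \<zero>} \<and> {s. c s \<noteq> \<zero>} \<subseteq> A - {p}"
  by (simp add: free_pt_def)

lemma free_pt_zero [simp]: "\<zero>\<^bsub>free_pt R A p\<^esub> = (\<lambda>s. \<zero>)"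
  by (simp add: free_pt_def)

lemma free_pt_add [simp]: "c \<oplus>\<^bsub>free_pt R A p\<^esub> d = (\<lambda>s. c s \<oplus> d s)"
  by (simp add: free_pt_def)

lemma free_pt_smult [simp]: "a \<odot>\<^bsub>free_pt R A p\<^esub> c = (\<lambda>s. a \<otimes> c s)"
  by (simp add: free_pt_def)

lemma free_pt_add_closed:
  assumes "c \<in> carrier (free_pt R A p)" and "d \<in> carrier (free_pt R A p)"
  shows "(\<lambda>s. c s \<oplus> d s) \<in> carrier (free_pt R A p)"
proof -
  have sub: "{s. c s \<oplus> d s \<noteq> \<zero>} \<subseteq> {s. c s \<noteq> \<zero>} \<union> {s. d s \<noteq> \<zero>}"
    by auto
  have "finite {s. c s \<oplus> d s \<noteq> \<zero>}"
    by (rule finite_subset[OF sub]) (use assms in \<open>simp add: free_pt_carrier\<close>)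
  with sub assms show ?thesis
    by (auto simp: free_pt_carrier)
qed

lemma free_pt_smult_closed:
  assumes "a \<in> carrier R" and "c \<in> carrier (free_pt R A p)"
  shows "(\<lambda>s. a \<otimes> c s) \<in> carrier (free_pt R A p)"
proof -
  have sub: "{s. a \<otimes> c s \<noteq> \<zero>} \<subseteq> {s. c s \<noteq> \<zero>}"
    using assms(1) by auto
  have "finite {s. a \<otimes> c s \<noteq> \<zero>}"
    by (rule finite_subset[OF sub]) (use assms in \<open>simp add: free_pt_carrier\<close>)
  with sub assms show ?thesis
    by (auto simp: free_pt_carrier)
qed

lemma free_pt_vectorspace: "vectorspace R (free_pt R A p)"
proof (rule vs_criteria)
  show "\<forall>v\<in>carrier (free_pt R A p). \<exists>neg_v\<in>carrier (free_pt R A p).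
          v \<oplus>\<^bsub>free_pt R A p\<^esub> neg_v = \<zero>\<^bsub>free_pt R A p\<^esub>"
  proof
    fix v assume v: "v \<in> carrier (free_pt R A p)"
    then have "(\<lambda>s. \<ominus> \<one> \<otimes> v s) \<in> carrier (free_pt R A p)"
      by (intro free_pt_smult_closed) auto
    moreover have "v s \<oplus> \<ominus> \<one> \<otimes> v s = \<zero>" for s
    proof -
      have "v s \<in> carrier R"
        using v by (simp add: free_pt_carrier)
      then show ?thesis
        by (simp add: l_minus r_neg)
    qed
    ultimately show "\<exists>neg_v\<in>carrier (free_pt R A p).
          v \<oplus>\<^bsub>free_pt R A p\<^esub> neg_v = \<zero>\<^bsub>free_pt R A p\<^esub>"
      by (intro bexI) auto
  qed
qed (auto simp: free_pt_add_closed free_pt_smult_closed field_axioms,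
     auto simp: free_pt_carrier a_ac m_ac l_distr r_distr)

lemma pt_gen_closed: "s \<in> A \<Longrightarrow> pt_gen R p s \<in> carrier (free_pt R A p)"
  by (auto simp: free_pt_carrier pt_gen_def)

lemma pt_gen_pt: "pt_gen R p p = (\<lambda>s. \<zero>)"
  by (simp add: pt_gen_def)

lemma free_pt_finsum_apply:
  assumes "f \<in> T \<rightarrow> carrier (free_pt R A p)"
  shows "finsum (free_pt R A p) f T t = (\<Oplus>s\<in>T. f s t)"
proof -
  interpret E: vectorspace R "free_pt R A p"
    by (rule free_pt_vectorspace)
  show ?thesis
    using assms
  proof (induct T rule: infinite_finite_induct)
    case (insert s T)
    then have "(\<lambda>s. f s t) \<in> T \<rightarrow> carrier R" "f s t \<in> carrier R"
      by (auto simp: free_pt_carrier Pi_iff)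
    with insert show ?case
      by (simp add: Pi_def)
  qed simp_all
qed

lemma free_pt_expansion:
  assumes "c \<in> carrier (free_pt R A p)"
  shows "c = (\<Oplus>\<^bsub>free_pt R A p\<^esub>s\<in>{s. c s \<noteq> \<zero>}. c s \<odot>\<^bsub>free_pt R A p\<^esub> pt_gen R p s)"
proof
  fix t
  let ?S = "{s. c s \<noteq> \<zero>}"
  have c: "\<And>s. c s \<in> carrier R" "finite ?S" "?S \<subseteq> A - {p}"
    using assms by (auto simp: free_pt_carrier)
  have "(\<Oplus>\<^bsub>free_pt R A p\<^esub>s\<in>?S. c s \<odot>\<^bsub>free_pt R A p\<^esub> pt_gen R p s) t
      = (\<Oplus>s\<in>?S. (c s \<odot>\<^bsub>free_pt R A p\<^esub> pt_gen R p s) t)"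
    by (rule free_pt_finsum_apply)
      (use c in \<open>auto simp del: free_pt_smult intro!: module.smult_closed[OF vectorspace.axioms(1)[OF free_pt_vectorspace]] pt_gen_closed\<close>)
  also have "\<dots> = (\<Oplus>s\<in>?S. if t = s then c s else \<zero>)"
    by (rule finsum_cong') (use c in \<open>auto simp: pt_gen_def\<close>)
  also have "\<dots> = c t"
  proof (cases "t \<in> ?S")
    case True
    with c show ?thesis
      by (intro finsum_singleton) auto
  next
    case False
    then have "(\<Oplus>s\<in>?S. if t = s then c s else \<zero>) = (\<Oplus>s\<in>?S. \<zero>)"
      by (intro finsum_cong') auto
    with False show ?thesis
      by simp
  qed
  finally show "c t = (\<Oplus>\<^bsub>free_pt R A p\<^esub>s\<in>?S. c s \<odot>\<^bsub>free_pt R A p\<^esub> pt_gen R p s) t"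
    by simp
qed

text \<open>The uniqueness half of the universal property: by \<open>free_pt_expansion\<close> the
  generators span. Functor laws and naturality out of free spaces are all reduced to generators by
  it.\<close>

lemma free_pt_linear_eq:
  assumes "linear_map R (free_pt R A p) W S" and "linear_map R (free_pt R A p) W T"
    and "\<And>s. s \<in> A \<Longrightarrow> S (pt_gen R p s) = T (pt_gen R p s)"
    and "c \<in> carrier (free_pt R A p)"
  shows "S c = T c"
proof -
  let ?E = "free_pt R A p" and ?S = "{s. c s \<noteq> \<zero>}"
  interpret W: vectorspace R W
    using assms(1) by (simp add: linear_map_def)
  interpret E: vectorspace R ?E
    by (rule free_pt_vectorspace)
  have c: "\<And>s. c s \<in> carrier R" "?S \<subseteq> A"
    using assms(4) by (auto simp: free_pt_carrier)
  have Pi: "(\<lambda>s. c s \<odot>\<^bsub>?E\<^esub> pt_gen R p s) \<in> ?S \<rightarrow> carrier ?E"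
    using c by (auto simp del: free_pt_smult intro!: E.smult_closed pt_gen_closed)
  have gen: "S (c s \<odot>\<^bsub>?E\<^esub> pt_gen R p s) = T (c s \<odot>\<^bsub>?E\<^esub> pt_gen R p s)" if "s \<in> ?S" for s
  proof -
    have s: "s \<in> A"
      using that c by auto
    then have "pt_gen R p s \<in> carrier ?E"
      by (rule pt_gen_closed)
    then show ?thesis
      using linear_map.T_smult[OF assms(1)] linear_map.T_smult[OF assms(2)] c(1) assms(3)[OF s]
      by metis
  qed
  have "S c = (\<Oplus>\<^bsub>W\<^esub>s\<in>?S. S (c s \<odot>\<^bsub>?E\<^esub> pt_gen R p s))"
    using linear_map_finsum[OF assms(1) Pi] free_pt_expansion[OF assms(4)] by simp
  also have "\<dots> = (\<Oplus>\<^bsub>W\<^esub>s\<in>?S. T (c s \<odot>\<^bsub>?E\<^esub> pt_gen R p s))"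
  proof (rule W.finsum_cong'[OF refl])
    show "(\<lambda>s. T (c s \<odot>\<^bsub>?E\<^esub> pt_gen R p s)) \<in> ?S \<rightarrow> carrier W"
      using Pi linear_map.T_im[OF assms(2)] by blast
  qed (rule gen)
  also have "\<dots> = T c"
    using linear_map_finsum[OF assms(2) Pi] free_pt_expansion[OF assms(4)] by simp
  finally show ?thesis .
qed

text \<open>Extra indices contribute zero terms. Two vectors and their sum have different supports
  in general; a common finite index set makes the three lifts comparable.\<close>

lemma free_lift_superset:
  assumes "vectorspace R W" and "g \<in> A \<rightarrow> carrier W" and "c \<in> carrier (free_pt R A p)"
    and "finite T" and "{s. c s \<noteq> \<zero>} \<subseteq> T" and "T \<subseteq> A"
  shows "free_lift R W g c = (\<Oplus>\<^bsub>W\<^esub>s\<in>T. c s \<odot>\<^bsub>W\<^esub> g s)"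
proof -
  interpret W: vectorspace R W by fact
  have c: "\<And>s. c s \<in> carrier R"
    using assms(3) by (auto simp: free_pt_carrier)
  show ?thesis
    unfolding free_lift_def
    by (rule W.add.finprod_mono_neutral_cong_left)
      (use assms c in \<open>auto intro!: W.smult_closed W.smult_l_null\<close>)
qed

lemma free_lift_linear:
  assumes "vectorspace R W" and "g \<in> A \<rightarrow> carrier W"
  shows "linear_map R (free_pt R A p) W (free_lift R W g)"
proof (rule linear_mapI[OF free_pt_vectorspace assms(1)])
  interpret W: vectorspace R W by fact
  have g: "g s \<in> carrier W" if "s \<in> A" for s
    using that assms(2) by auto
  show "free_lift R W g c \<in> carrier W" if "c \<in> carrier (free_pt R A p)" for c
    unfolding free_lift_def by (rule W.finsum_closed) (use that g in \<open>auto simp: free_pt_carrier\<close>)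
  show "free_lift R W g (c \<oplus>\<^bsub>free_pt R A p\<^esub> d) = free_lift R W g c \<oplus>\<^bsub>W\<^esub> free_lift R W g d"
    if c: "c \<in> carrier (free_pt R A p)" and d: "d \<in> carrier (free_pt R A p)" for c d
  proof -
    let ?T = "{s. c s \<noteq> \<zero>} \<union> {s. d s \<noteq> \<zero>}"
    have T: "finite ?T" "?T \<subseteq> A"
      using c d by (auto simp: free_pt_carrier)
    have cd: "\<And>s. c s \<in> carrier R" "\<And>s. d s \<in> carrier R"
      using c d by (auto simp: free_pt_carrier)
    have "free_lift R W g (\<lambda>s. c s \<oplus> d s) = (\<Oplus>\<^bsub>W\<^esub>s\<in>?T. (c s \<oplus> d s) \<odot>\<^bsub>W\<^esub> g s)"
      by (rule free_lift_superset[OF assms free_pt_add_closed[OF c d] T(1) _ T(2)]) auto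
    also have "\<dots> = (\<Oplus>\<^bsub>W\<^esub>s\<in>?T. c s \<odot>\<^bsub>W\<^esub> g s \<oplus>\<^bsub>W\<^esub> d s \<odot>\<^bsub>W\<^esub> g s)"
      by (rule W.finsum_cong') (use T cd g in \<open>auto simp: W.smult_l_distr subset_iff\<close>)
    also have "\<dots> = (\<Oplus>\<^bsub>W\<^esub>s\<in>?T. c s \<odot>\<^bsub>W\<^esub> g s) \<oplus>\<^bsub>W\<^esub> (\<Oplus>\<^bsub>W\<^esub>s\<in>?T. d s \<odot>\<^bsub>W\<^esub> g s)"
      by (rule W.finsum_addf) (use T cd g in \<open>auto simp: subset_iff\<close>)
    also have "\<dots> = free_lift R W g c \<oplus>\<^bsub>W\<^esub> free_lift R W g d"
      using free_lift_superset[OF assms c T(1) _ T(2)] free_lift_superset[OF assms d T(1) _ T(2)]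
      by simp
    finally show ?thesis
      by simp
  qed
  show "free_lift R W g (a \<odot>\<^bsub>free_pt R A p\<^esub> c) = a \<odot>\<^bsub>W\<^esub> free_lift R W g c"
    if a: "a \<in> carrier R" and c: "c \<in> carrier (free_pt R A p)" for a c
  proof -
    let ?T = "{s. c s \<noteq> \<zero>}"
    have T: "finite ?T" "?T \<subseteq> A"
      using c by (auto simp: free_pt_carrier)
    have cc: "\<And>s. c s \<in> carrier R"
      using c by (auto simp: free_pt_carrier)
    have "free_lift R W g (\<lambda>s. a \<otimes> c s) = (\<Oplus>\<^bsub>W\<^esub>s\<in>?T. (a \<otimes> c s) \<odot>\<^bsub>W\<^esub> g s)"
      by (rule free_lift_superset[OF assms free_pt_smult_closed[OF a c] T(1) _ T(2)]) (use a in auto)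
    also have "\<dots> = (\<Oplus>\<^bsub>W\<^esub>s\<in>?T. a \<odot>\<^bsub>W\<^esub> (c s \<odot>\<^bsub>W\<^esub> g s))"
      by (rule W.finsum_cong') (use T cc g a in \<open>auto simp: W.smult_assoc1 subset_iff\<close>)
    also have "\<dots> = a \<odot>\<^bsub>W\<^esub> free_lift R W g c"
      unfolding free_lift_def
      by (rule W.finsum_smult[symmetric]) (use T cc g a in \<open>auto simp: subset_iff\<close>)
    finally show ?thesis
      by simp
  qed
qed

lemma free_lift_gen:
  assumes "vectorspace R W" and "g \<in> A \<rightarrow> carrier W" and "g p = \<zero>\<^bsub>W\<^esub>" and "s \<in> A"
  shows "free_lift R W g (pt_gen R p s) = g s"
proof -
  interpret W: vectorspace R W by fact
  have "{t. pt_gen R p s t \<noteq> \<zero>} = (if s = p then {} else {s})"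
    by (auto simp: pt_gen_def)
  moreover have "g s \<in> carrier W"
    using assms(2,4) by auto
  ultimately show ?thesis
    using assms(3) by (auto simp: free_lift_def pt_gen_def)
qed

text \<open>Identifies the fibre sums with a lift, so that linearity and functoriality come from the
  universal property and fibres need not be manipulated again.\<close>

lemma free_pt_map_eq_lift:
  assumes "h \<in> A \<rightarrow> A'" and "c \<in> carrier (free_pt R A p)"
  shows "free_pt_map R q h c = free_lift R (free_pt R A' q) (\<lambda>s. pt_gen R q (h s)) c"
proof
  fix t
  let ?S = "{s. c s \<noteq> \<zero>}"
  interpret E: vectorspace R "free_pt R A' q"
    by (rule free_pt_vectorspace)
  have c: "\<And>s. c s \<in> carrier R" "finite ?S" "?S \<subseteq> A - {p}"
    using assms(2) by (auto simp: free_pt_carrier)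
  have Pi: "(\<lambda>s. c s \<odot>\<^bsub>free_pt R A' q\<^esub> pt_gen R q (h s)) \<in> ?S \<rightarrow> carrier (free_pt R A' q)"
    using c assms(1) by (auto simp del: free_pt_smult intro!: E.smult_closed pt_gen_closed)
  have "free_lift R (free_pt R A' q) (\<lambda>s. pt_gen R q (h s)) c t
      = (\<Oplus>s\<in>?S. (c s \<odot>\<^bsub>free_pt R A' q\<^esub> pt_gen R q (h s)) t)"
    unfolding free_lift_def by (rule free_pt_finsum_apply[OF Pi])
  also have "\<dots> = free_pt_map R q h c t"
  proof (cases "t = q")
    case True
    then have "(\<Oplus>s\<in>?S. (c s \<odot>\<^bsub>free_pt R A' q\<^esub> pt_gen R q (h s)) t) = (\<Oplus>s\<in>?S. \<zero>)"
      using c by (intro finsum_cong') (auto simp: pt_gen_def)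
    with True show ?thesis
      by (simp add: free_pt_map_def)
  next
    \<comment> \<open>Off the base point, the term of \<open>s\<close> has coefficient
      \<open>c s\<close> at \<open>t\<close> if \<open>h s = t\<close> and zero otherwise, so the
      fibre sum extends to the whole support.\<close>
    case False
    have "(\<Oplus>s\<in>{s. c s \<noteq> \<zero> \<and> h s = t}. c s)
        = (\<Oplus>s\<in>?S. (c s \<odot>\<^bsub>free_pt R A' q\<^esub> pt_gen R q (h s)) t)"
      by (rule add.finprod_mono_neutral_cong_left) (use False c in \<open>auto simp: pt_gen_def\<close>)
    with False show ?thesis
      by (simp add: free_pt_map_def)
  qed
  finally show "free_pt_map R q h c t
      = free_lift R (free_pt R A' q) (\<lambda>s. pt_gen R q (h s)) c t" ..
qed

lemma free_pt_map_linear: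
  assumes "h \<in> A \<rightarrow> A'"
  shows "linear_map R (free_pt R A p) (free_pt R A' q) (free_pt_map R q h)"
proof (rule linear_map_cong[OF free_lift_linear[OF free_pt_vectorspace]])
  show "(\<lambda>s. pt_gen R q (h s)) \<in> A \<rightarrow> carrier (free_pt R A' q)"
    using assms by (auto intro!: pt_gen_closed)
qed (rule free_pt_map_eq_lift[OF assms])

lemma free_pt_map_pt_gen:
  assumes "h \<in> A \<rightarrow> A'" and "h p = q" and "s \<in> A"
  shows "free_pt_map R q h (pt_gen R p s) = pt_gen R q (h s)"
  using free_lift_gen[OF free_pt_vectorspace, of "\<lambda>s. pt_gen R q (h s)" A A' q p s]
  by (subst free_pt_map_eq_lift[OF assms(1) pt_gen_closed[OF assms(3)]])
    (use assms in \<open>auto simp: pt_gen_pt intro!: pt_gen_closed\<close>)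

text \<open>On generators the functor laws are those of \<open>S\<close>.\<close>

lemma free_pt_star_vect_rep:
  assumes "small_category X" and "pointed_rep X S"
  shows "vect_rep X R (free_pt_star X R S)"
proof -
  interpret X: small_category X by fact
  interpret S: pointed_rep X S by fact
  have map: "pmap S f \<in> pset S (Dom X f) \<rightarrow> pset S (Cod X f)" if "f \<in> Arr X" for f
    using S.pmap_in[OF that] by auto
  have lin: "linear_map R (free_pt R (pset S (Dom X f)) (pt S (Dom X f)))
      (free_pt R (pset S (Cod X f)) (pt S (Cod X f))) (free_pt_map R (pt S (Cod X f)) (pmap S f))"
    if "f \<in> Arr X" for f
    by (rule free_pt_map_linear[OF map[OF that]])
  note gen = free_pt_map_pt_gen[OF map S.pmap_pt]
  show ?thesis
  proof (rule vect_rep.intro)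
    show "vectorspace R (VS (free_pt_star X R S) x)" for x
      by (simp add: free_pt_star_def free_pt_vectorspace)
  next
    fix f assume "f \<in> Arr X"
    then show "linear_map R (VS (free_pt_star X R S) (Dom X f)) (VS (free_pt_star X R S) (Cod X f))
        (act (free_pt_star X R S) f)"
      by (simp add: free_pt_star_def lin)
  next
    fix x v assume x: "x \<in> Obj X" and v: "v \<in> carrier (VS (free_pt_star X R S) x)"
    have "free_pt_map R (pt S x) (pmap S (Id X x)) v = v"
    proof (rule free_pt_linear_eq[where T = "\<lambda>v. v"])
      show "linear_map R (free_pt R (pset S x) (pt S x)) (free_pt R (pset S x) (pt S x))
          (free_pt_map R (pt S x) (pmap S (Id X x)))"
        using lin[OF X.Id_Arr[OF x]] by (simp add: X.Dom_Id X.Cod_Id x)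
      show "linear_map R (free_pt R (pset S x) (pt S x)) (free_pt R (pset S x) (pt S x)) (\<lambda>v. v)"
        by (rule linear_map_id[OF free_pt_vectorspace])
      show "free_pt_map R (pt S x) (pmap S (Id X x)) (pt_gen R (pt S x) s) = pt_gen R (pt S x) s"
        if "s \<in> pset S x" for s
        using gen[OF X.Id_Arr[OF x] X.Id_Arr[OF x]] that
        by (simp add: X.Dom_Id X.Cod_Id x S.pmap_Id)
      show "v \<in> carrier (free_pt R (pset S x) (pt S x))"
        using v by (simp add: free_pt_star_def)
    qed
    then show "act (free_pt_star X R S) (Id X x) v = v"
      by (simp add: free_pt_star_def X.Cod_Id x)
  next
    fix f g v
    assume f: "f \<in> Arr X" and g: "g \<in> Arr X" and fg: "Cod X f = Dom X g"
      and v: "v \<in> carrier (VS (free_pt_star X R S) (Dom X f))"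
    note c = X.Comp_Arr[OF f g fg] X.Dom_Comp[OF f g fg] X.Cod_Comp[OF f g fg]
    have "free_pt_map R (pt S (Cod X g)) (pmap S (Comp X g f)) v
        = free_pt_map R (pt S (Cod X g)) (pmap S g) (free_pt_map R (pt S (Cod X f)) (pmap S f) v)"
    proof (rule free_pt_linear_eq[where T = "\<lambda>v. free_pt_map R (pt S (Cod X g)) (pmap S g)
            (free_pt_map R (pt S (Cod X f)) (pmap S f) v)"])
      show "linear_map R (free_pt R (pset S (Dom X f)) (pt S (Dom X f)))
          (free_pt R (pset S (Cod X g)) (pt S (Cod X g)))
          (free_pt_map R (pt S (Cod X g)) (pmap S (Comp X g f)))"
        using lin[OF c(1)] by (simp add: c)
      show "linear_map R (free_pt R (pset S (Dom X f)) (pt S (Dom X f)))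
          (free_pt R (pset S (Cod X g)) (pt S (Cod X g)))
          (\<lambda>v. free_pt_map R (pt S (Cod X g)) (pmap S g) (free_pt_map R (pt S (Cod X f)) (pmap S f) v))"
        using linear_map_comp[OF lin[OF f] lin[OF g, folded fg]] .
      show "free_pt_map R (pt S (Cod X g)) (pmap S (Comp X g f)) (pt_gen R (pt S (Dom X f)) s)
          = free_pt_map R (pt S (Cod X g)) (pmap S g)
              (free_pt_map R (pt S (Cod X f)) (pmap S f) (pt_gen R (pt S (Dom X f)) s))"
        if s: "s \<in> pset S (Dom X f)" for s
        using gen[OF c(1) c(1)] gen[OF f f s] gen[OF g g, folded fg, OF S.pmap_in[OF f s]] s
        by (simp add: c S.pmap_Comp[OF f g fg s])
      show "v \<in> carrier (free_pt R (pset S (Dom X f)) (pt S (Dom X f)))"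
        using v by (simp add: free_pt_star_def)
    qed
    then show "act (free_pt_star X R S) (Comp X g f) v
        = act (free_pt_star X R S) g (act (free_pt_star X R S) f v)"
      by (simp add: free_pt_star_def c)
  qed
qed

end

section \<open>Retracts and direct summands\<close>

lemma fin_direct_sum_vectorspace:
  assumes "field K" and "\<And>i. i < k \<Longrightarrow> vectorspace K (V i)"
  shows "vectorspace K (fin_direct_sum_vs k V)"
proof -
  interpret field K by fact
  have m: "Module.module K (V i)" if "i < k" for i
    using assms(2)[OF that] by (rule vectorspace.axioms(1))
  have g: "abelian_group (V i)" if "i < k" for i
    using m[OF that] by (simp add: Module.module_def)
  note mon = abelian_group.axioms(1)[OF g]
  show ?thesis
  proof (rule vs_criteria[OF assms(1)])
    show "\<forall>v\<in>carrier (fin_direct_sum_vs k V). \<exists>neg_v\<in>carrier (fin_direct_sum_vs k V).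
      v \<oplus>\<^bsub>fin_direct_sum_vs k V\<^esub> neg_v = \<zero>\<^bsub>fin_direct_sum_vs k V\<^esub>"
    proof
      fix v assume v: "v \<in> carrier (fin_direct_sum_vs k V)"
      show "\<exists>neg_v\<in>carrier (fin_direct_sum_vs k V).
          v \<oplus>\<^bsub>fin_direct_sum_vs k V\<^esub> neg_v = \<zero>\<^bsub>fin_direct_sum_vs k V\<^esub>"
        by (rule bexI[of _ "\<lambda>i\<in>{..<k}. \<ominus>\<^bsub>V i\<^esub> v i"])
          (use v in \<open>auto simp: fin_direct_sum_vs_def fun_eq_iff PiE_iff
            abelian_group.r_neg[OF g] abelian_group.a_inv_closed[OF g]\<close>)
    qed
  qed (auto simp: fin_direct_sum_vs_def fun_eq_iff PiE_iff extensional_def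
      abelian_monoid.zero_closed[OF mon] abelian_monoid.a_closed[OF mon]
      abelian_monoid.a_assoc[OF mon] abelian_monoid.r_zero[OF mon]
      Module.module.smult_closed[OF m] Module.module.smult_one[OF m] Module.module.smult_assoc1[OF m]
      Module.module.smult_l_distr[OF m] Module.module.smult_r_distr[OF m]
      intro!: abelian_monoid.a_comm[OF mon])
qed

lemma rep_iso_refl:
  assumes "vect_rep X F R"
  shows "rep_iso X F R R"
  unfolding rep_iso_def rep_hom_def
  by (intro exI[of _ "\<lambda>_ v. v"]) (auto intro: linear_map_id vect_rep.VS_vectorspace[OF assms])

text \<open>Membership in the additive image asks for a finite direct sum; \<open>R\<close> will be
  presented as a sum with one term.\<close>

lemma rep_iso_fin_direct_sum_one:
  fixes R :: "('o, 'a, 'f, 'v) linrep"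
  assumes "field F" and "vect_rep X F R"
  shows "rep_iso X F R (rep_fin_direct_sum 1 (\<lambda>_. R))"
proof -
  interpret R: vect_rep X F R by fact
  let ?D = "rep_fin_direct_sum 1 (\<lambda>_. R)"
  have vs: "vectorspace F (fin_direct_sum_vs 1 (\<lambda>_. VS R x))" if "x \<in> Obj X" for x
    by (rule fin_direct_sum_vectorspace) (use assms(1) R.VS_vectorspace[OF that] in auto)
  have "rep_hom X F R ?D (\<lambda>x v. \<lambda>i\<in>{..<1}. v)"
    unfolding rep_hom_def
  proof (intro conjI ballI)
    fix x assume x: "x \<in> Obj X"
    show "linear_map F (VS R x) (VS ?D x) (\<lambda>v. \<lambda>i\<in>{..<1}. v)"
      unfolding rep_fin_direct_sum_def
      by (simp only: linrep.simps, rule linear_mapI[OF R.VS_vectorspace[OF x] vs[OF x]])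
        (auto simp: fin_direct_sum_vs_def)
  qed (auto simp: rep_fin_direct_sum_def)
  moreover have "rep_hom X F ?D R (\<lambda>x u. u 0)"
    unfolding rep_hom_def
  proof (intro conjI ballI)
    fix x assume x: "x \<in> Obj X"
    show "linear_map F (VS ?D x) (VS R x) (\<lambda>u. u 0)"
      unfolding rep_fin_direct_sum_def
      by (simp only: linrep.simps, rule linear_mapI[OF vs[OF x] R.VS_vectorspace[OF x]])
        (auto simp: fin_direct_sum_vs_def)
  qed (auto simp: rep_fin_direct_sum_def)
  \<comment> \<open>Vectors of the sum are \<open>undefined\<close> at every index other than 0, so
    the component \<open>u 0\<close> determines \<open>u\<close>.\<close>
  moreover have "(\<lambda>i\<in>{..<1}. u 0) = u" if "u \<in> carrier (VS ?D x)" for x u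
  proof
    fix i
    have "u \<in> extensional {..<1}"
      using that by (simp add: rep_fin_direct_sum_def fin_direct_sum_vs_def PiE_iff)
    then show "(\<lambda>i\<in>{..<1}. u 0) i = u i"
      by (cases "i = 0") (simp_all add: extensional_def)
  qed
  ultimately show ?thesis
    unfolding rep_iso_def
    by (intro exI[of _ "\<lambda>x v. \<lambda>i\<in>{..<1}. v"] exI[of _ "\<lambda>x u. u 0"] conjI ballI) simp_all
qed

lemma retract_direct_summand:
  fixes D :: "('o, 'a, 'f, 'v) linrep" and E :: "('o, 'a, 'f, 'w) linrep"
  assumes "small_category X" and "vect_rep X F D" and "vect_rep X F E"
    and \<iota>: "rep_hom X F D E \<iota>" and \<pi>: "rep_hom X F E D \<pi>"
    and retract: "\<And>x v. \<lbrakk>x \<in> Obj X; v \<in> carrier (VS D x)\<rbrakk> \<Longrightarrow> \<pi> x (\<iota> x v) = v"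
  shows "direct_summand X F D E"
proof -
  interpret X: small_category X by fact
  interpret D: vect_rep X F D by fact
  interpret E: vect_rep X F E by fact
  have \<iota>_lin: "linear_map F (VS D x) (VS E x) (\<iota> x)"
    and \<pi>_lin: "linear_map F (VS E x) (VS D x) (\<pi> x)" if "x \<in> Obj X" for x
    using \<iota> \<pi> that by (auto simp: rep_hom_def)
  have \<iota>_nat: "\<iota> (Cod X f) (act D f v) = act E f (\<iota> (Dom X f) v)"
    if "f \<in> Arr X" "v \<in> carrier (VS D (Dom X f))" for f v
    using \<iota> that by (auto simp: rep_hom_def)
  have \<pi>_nat: "\<pi> (Cod X f) (act E f e) = act D f (\<pi> (Dom X f) e)"
    if "f \<in> Arr X" "e \<in> carrier (VS E (Dom X f))" for f e
    using \<pi> that by (auto simp: rep_hom_def)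
  define U where "U x = {e \<in> carrier (VS E x). \<pi> x e = \<zero>\<^bsub>VS D x\<^esub>}" for x
  \<comment> \<open>The kernel of \<pi> keeps the operations of \<open>E\<close> and only shrinks
    the carriers, so its vectors have the type that \<open>direct_summand\<close> prescribes for a
    complement.\<close>
  define K where "K = \<lparr>VS = \<lambda>x. (VS E x)\<lparr>carrier := U x\<rparr>, act = act E\<rparr>"
  have K_simps [simp]: "VS K x = (VS E x)\<lparr>carrier := U x\<rparr>" "act K = act E" for x
    by (simp_all add: K_def)
  have U_vs: "vectorspace F ((VS E x)\<lparr>carrier := U x\<rparr>)" if x: "x \<in> Obj X" for x
  proof -
    interpret E: vectorspace F "VS E x"
      by (rule E.VS_vectorspace[OF x])
    interpret \<pi>: linear_map F "VS E x" "VS D x" "\<pi> x"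
      by (rule \<pi>_lin[OF x])
    show ?thesis
      using E.subspace_is_vs[OF \<pi>.kerT_is_subspace] unfolding U_def \<pi>.ker_def .
  qed
  \<comment> \<open>Naturality of \<pi> makes the kernels stable under the action.\<close>
  have act_U: "act E f e \<in> U (Cod X f)" if f: "f \<in> Arr X" and e: "e \<in> U (Dom X f)" for f e
    using that linear_map.T_im[OF E.act_linear[OF f]] linear_map.T0_is_0[OF D.act_linear[OF f]]
    by (auto simp: U_def \<pi>_nat)
  have K: "vect_rep X F K"
  proof (rule vect_rep.intro)
    fix f assume f: "f \<in> Arr X"
    interpret f: linear_map F "VS E (Dom X f)" "VS E (Cod X f)" "act E f"
      by (rule E.act_linear[OF f])
    show "linear_map F (VS K (Dom X f)) (VS K (Cod X f)) (act K f)"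
      unfolding K_simps
      by (rule linear_mapI[OF U_vs[OF X.Dom_Obj[OF f]] U_vs[OF X.Cod_Obj[OF f]]])
        (use f in \<open>simp_all add: act_U, simp_all add: U_def\<close>)
  qed (simp_all add: U_vs, simp_all add: E.act_Id E.act_Comp U_def)
  let ?S = "rep_direct_sum D K"
  \<comment> \<open>The idempotent \<iota> \<pi> splits e into \<iota>(\<pi> e) and e -
    \<iota>(\<pi> e); the latter lies in the kernel because \<pi> \<iota> is the identity. The
    inverse \<open>?\<psi>\<close> adds the two parts up again.\<close>
  let ?\<phi> = "\<lambda>x e. (\<pi> x e, e \<ominus>\<^bsub>VS E x\<^esub> \<iota> x (\<pi> x e))"
  let ?\<psi> = "\<lambda>x vk. \<iota> x (fst vk) \<oplus>\<^bsub>VS E x\<^esub> snd vk"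
  have sum_carrier: "carrier (VS ?S x) = carrier (VS D x) \<times> U x" for x
    by (simp add: rep_direct_sum_def direct_sum_def)
  have \<phi>: "rep_hom X F E ?S ?\<phi>"
    unfolding rep_hom_def
  proof (intro conjI ballI)
    fix x assume x: "x \<in> Obj X"
    interpret D: vectorspace F "VS D x"
      by (rule D.VS_vectorspace[OF x])
    interpret \<pi>: linear_map F "VS E x" "VS D x" "\<pi> x"
      by (rule \<pi>_lin[OF x])
    interpret \<iota>: linear_map F "VS D x" "VS E x" "\<iota> x"
      by (rule \<iota>_lin[OF x])
    have "linear_map F (VS E x) (VS E x) (\<lambda>e. e \<ominus>\<^bsub>VS E x\<^esub> \<iota> x (\<pi> x e))"
      by (intro linear_map_minus linear_map_id linear_map_comp[OF \<pi>_lin[OF x] \<iota>_lin[OF x]]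
          E.VS_vectorspace x)
    then have "linear_map F (VS E x) ((VS E x)\<lparr>carrier := U x\<rparr>) (\<lambda>e. e \<ominus>\<^bsub>VS E x\<^esub> \<iota> x (\<pi> x e))"
      by (rule linear_map_into_subspace[OF _ U_vs[OF x]])
        (simp add: U_def retract[OF x] D.minus_eq D.r_neg)
    then show "linear_map F (VS E x) (VS ?S x) (?\<phi> x)"
      unfolding rep_direct_sum_def linrep.simps K_simps
      by (rule linear_map_direct_sum[OF \<pi>_lin[OF x]])
  next
    fix f e assume f: "f \<in> Arr X" and e: "e \<in> carrier (VS E (Dom X f))"
    have "\<pi> (Dom X f) e \<in> carrier (VS D (Dom X f))"
      by (rule linear_map.T_im[OF \<pi>_lin[OF X.Dom_Obj[OF f]] e])
    moreover from this have "\<iota> (Dom X f) (\<pi> (Dom X f) e) \<in> carrier (VS E (Dom X f))"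
      by (rule linear_map.T_im[OF \<iota>_lin[OF X.Dom_Obj[OF f]]])
    ultimately show "?\<phi> (Cod X f) (act E f e) = act ?S f (?\<phi> (Dom X f) e)"
      using f e
      by (simp add: rep_direct_sum_def \<pi>_nat \<iota>_nat linear_map.T_minus[OF E.act_linear[OF f]])
  qed
  have \<psi>: "rep_hom X F ?S E ?\<psi>"
    unfolding rep_hom_def
  proof (intro conjI ballI)
    fix x assume x: "x \<in> Obj X"
    interpret E: vectorspace F "VS E x"
      by (rule E.VS_vectorspace[OF x])
    interpret \<iota>: linear_map F "VS D x" "VS E x" "\<iota> x"
      by (rule \<iota>_lin[OF x])
    have vs: "vectorspace F (VS ?S x)"
      unfolding rep_direct_sum_def linrep.simps K_simps
      by (rule direct_sum_is_vs[OF D.VS_vectorspace[OF x] U_vs[OF x]])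
    show "linear_map F (VS ?S x) (VS E x) (?\<psi> x)"
      by (rule linear_mapI[OF vs E.vectorspace_axioms])
        (auto simp: rep_direct_sum_def direct_sum_def U_def E.a_ac E.smult_r_distr)
  next
    fix f vk assume f: "f \<in> Arr X" and vk: "vk \<in> carrier (VS ?S (Dom X f))"
    obtain v k where vk_eq: "vk = (v, k)"
      by (cases vk)
    have v: "v \<in> carrier (VS D (Dom X f))" and k: "k \<in> carrier (VS E (Dom X f))"
      using vk by (auto simp: vk_eq sum_carrier U_def)
    have "\<iota> (Dom X f) v \<in> carrier (VS E (Dom X f))"
      by (rule linear_map.T_im[OF \<iota>_lin[OF X.Dom_Obj[OF f]] v])
    then show "?\<psi> (Cod X f) (act ?S f vk) = act E f (?\<psi> (Dom X f) vk)"
      using f v k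
      by (simp add: vk_eq rep_direct_sum_def \<iota>_nat linear_map.T_add[OF E.act_linear[OF f]])
  qed
  have "\<forall>x\<in>Obj X. (\<forall>e\<in>carrier (VS E x). ?\<psi> x (?\<phi> x e) = e) \<and>
      (\<forall>w\<in>carrier (VS ?S x). ?\<phi> x (?\<psi> x w) = w)"
  proof (intro ballI conjI)
    fix x e assume x: "x \<in> Obj X" and e: "e \<in> carrier (VS E x)"
    interpret E: vectorspace F "VS E x"
      by (rule E.VS_vectorspace[OF x])
    have "\<iota> x (\<pi> x e) \<in> carrier (VS E x)"
      by (rule linear_map.T_im[OF \<iota>_lin[OF x] linear_map.T_im[OF \<pi>_lin[OF x] e]])
    with e show "?\<psi> x (?\<phi> x e) = e"
      by (simp add: E.minus_eq E.a_ac E.r_neg1 E.r_neg2 E.r_neg)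
  next
    fix x w assume x: "x \<in> Obj X" and w: "w \<in> carrier (VS ?S x)"
    interpret D: vectorspace F "VS D x"
      by (rule D.VS_vectorspace[OF x])
    interpret E: vectorspace F "VS E x"
      by (rule E.VS_vectorspace[OF x])
    obtain v k where w_eq: "w = (v, k)"
      by (cases w)
    have v: "v \<in> carrier (VS D x)" and k: "k \<in> carrier (VS E x)" "\<pi> x k = \<zero>\<^bsub>VS D x\<^esub>"
      using w by (auto simp: w_eq sum_carrier U_def)
    have \<iota>v: "\<iota> x v \<in> carrier (VS E x)"
      by (rule linear_map.T_im[OF \<iota>_lin[OF x] v])
    then have "\<pi> x (\<iota> x v \<oplus>\<^bsub>VS E x\<^esub> k) = v"
      using v k by (simp add: linear_map.T_add[OF \<pi>_lin[OF x]] retract[OF x])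
    moreover have "(\<iota> x v \<oplus>\<^bsub>VS E x\<^esub> k) \<ominus>\<^bsub>VS E x\<^esub> \<iota> x v = k"
      using \<iota>v k by (simp add: E.minus_eq E.a_ac E.r_neg1 E.r_neg2 E.r_neg)
    ultimately show "?\<phi> x (?\<psi> x w) = w"
      by (simp add: w_eq)
  qed
  with \<phi> \<psi> have "rep_iso X F E ?S"
    unfolding rep_iso_def by blast
  with K assms(2) show ?thesis
    unfolding direct_summand_def by blast
qed

section \<open>Averaging over the roots of unity\<close>

text \<open>For a vector \<open>v\<close> and a map \<open>\<tau>\<close> naming the multiples \<open>\<zeta> v\<close> by generators, this is the projection
  of the generator \<open>\<tau> v\<close> to the subspace on which the generator permutation \<open>\<tau> v \<mapsto> \<tau> (\<zeta> v)\<close> acts as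
  multiplication by \<open>\<zeta>\<close>.\<close>

definition twisted_gen ::
  "('f, 'r) ring_scheme \<Rightarrow> nat \<Rightarrow> ('f, 'v) module \<Rightarrow> 's set \<Rightarrow> 's \<Rightarrow> ('v \<Rightarrow> 's) \<Rightarrow> 'v \<Rightarrow> 's \<Rightarrow> 'f"
  where
  "twisted_gen F n V A p \<tau> v =
     inv\<^bsub>F\<^esub> ([n] \<cdot>\<^bsub>F\<^esub> \<one>\<^bsub>F\<^esub>) \<odot>\<^bsub>free_pt F A p\<^esub>
       (\<Oplus>\<^bsub>free_pt F A p\<^esub>\<zeta>\<in>unity_roots F n.
          inv\<^bsub>F\<^esub> \<zeta> \<odot>\<^bsub>free_pt F A p\<^esub> pt_gen F p (\<tau> (\<zeta> \<odot>\<^bsub>V\<^esub> v)))"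

context field
begin

lemma twisted_gen_summand_closed:
  assumes "0 < n" and "\<And>\<zeta>. \<zeta> \<in> unity_roots R n \<Longrightarrow> \<tau> (\<zeta> \<odot>\<^bsub>V\<^esub> v) \<in> A"
  shows "(\<lambda>\<zeta>. inv \<zeta> \<odot>\<^bsub>free_pt R A p\<^esub> pt_gen R p (\<tau> (\<zeta> \<odot>\<^bsub>V\<^esub> v)))
    \<in> unity_roots R n \<rightarrow> carrier (free_pt R A p)"
proof -
  interpret E: vectorspace R "free_pt R A p"
    by (rule free_pt_vectorspace)
  show ?thesis
    using unity_roots_carrier[OF unity_roots_inv[OF assms(1)]] pt_gen_closed[OF assms(2)]
    by (auto simp del: free_pt_smult)
qed

lemma twisted_gen_closed:
  assumes "primitive_root_of_unity R n z"
    and "\<And>\<zeta>. \<zeta> \<in> unity_roots R n \<Longrightarrow> \<tau> (\<zeta> \<odot>\<^bsub>V\<^esub> v) \<in> A"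
  shows "twisted_gen R n V A p \<tau> v \<in> carrier (free_pt R A p)"
proof -
  interpret E: vectorspace R "free_pt R A p"
    by (rule free_pt_vectorspace)
  have "0 < n"
    using assms(1) by (simp add: primitive_root_of_unity_def)
  then show ?thesis
    unfolding twisted_gen_def
    using inv_nonzero(1)[OF _ roots_of_unity(3)[OF assms(1)]]
    by (intro E.smult_closed E.finsum_closed twisted_gen_summand_closed assms(2)) simp_all
qed

text \<open>Common to both uses below: \<pi>, where the target is \<open>R\<close>, and the action
  of a morphism, where the target is again a free space.\<close>

lemma linear_map_twisted_gen:
  assumes "primitive_root_of_unity R n z"
    and "\<And>\<zeta>. \<zeta> \<in> unity_roots R n \<Longrightarrow> \<tau> (\<zeta> \<odot>\<^bsub>V\<^esub> v) \<in> A"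
    and T: "linear_map R (free_pt R A p) W T"
  shows "T (twisted_gen R n V A p \<tau> v) = inv ([n] \<cdot> \<one>) \<odot>\<^bsub>W\<^esub>
    (\<Oplus>\<^bsub>W\<^esub>\<zeta>\<in>unity_roots R n. inv \<zeta> \<odot>\<^bsub>W\<^esub> T (pt_gen R p (\<tau> (\<zeta> \<odot>\<^bsub>V\<^esub> v))))"
proof -
  let ?E = "free_pt R A p"
  interpret E: vectorspace R ?E
    by (rule free_pt_vectorspace)
  interpret W: vectorspace R W
    using T by (simp add: linear_map_def)
  have n: "0 < n"
    using assms(1) by (simp add: primitive_root_of_unity_def)
  let ?g = "\<lambda>\<zeta>. pt_gen R p (\<tau> (\<zeta> \<odot>\<^bsub>V\<^esub> v))"
  have g: "?g \<zeta> \<in> carrier ?E" if "\<zeta> \<in> unity_roots R n" for \<zeta>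
    by (rule pt_gen_closed[OF assms(2)[OF that]])
  have Pi: "(\<lambda>\<zeta>. inv \<zeta> \<odot>\<^bsub>?E\<^esub> ?g \<zeta>) \<in> unity_roots R n \<rightarrow> carrier ?E"
    by (rule twisted_gen_summand_closed[where \<tau> = \<tau> and V = V and v = v, OF n assms(2)])
  note inv = unity_roots_carrier[OF unity_roots_inv[OF n]]
  have "T (\<Oplus>\<^bsub>?E\<^esub>\<zeta>\<in>unity_roots R n. inv \<zeta> \<odot>\<^bsub>?E\<^esub> ?g \<zeta>)
      = (\<Oplus>\<^bsub>W\<^esub>\<zeta>\<in>unity_roots R n. T (inv \<zeta> \<odot>\<^bsub>?E\<^esub> ?g \<zeta>))"
    by (rule linear_map_finsum[OF T Pi])
  also have "\<dots> = (\<Oplus>\<^bsub>W\<^esub>\<zeta>\<in>unity_roots R n. inv \<zeta> \<odot>\<^bsub>W\<^esub> T (?g \<zeta>))"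
    by (rule W.finsum_cong'[OF refl])
      (use g inv linear_map.T_im[OF T] linear_map.T_smult[OF T] in \<open>auto simp del: free_pt_smult\<close>)
  finally show ?thesis
    unfolding twisted_gen_def
    using linear_map.T_smult[OF T inv_nonzero(1)[OF _ roots_of_unity(3)[OF assms(1)]]
        E.finsum_closed[OF Pi]] by simp
qed

text \<open>Each summand becomes the inverse of \<zeta> times \<zeta> v, that is v; there are
  exactly n of them, and the scalar in front cancels n.\<close>

lemma twisted_gen_retract:
  assumes "primitive_root_of_unity R n z"
    and "\<And>\<zeta>. \<zeta> \<in> unity_roots R n \<Longrightarrow> \<tau> (\<zeta> \<odot>\<^bsub>V\<^esub> v) \<in> A"
    and T: "linear_map R (free_pt R A p) V T" and v: "v \<in> carrier V"
    and T_gen: "\<And>\<zeta>. \<zeta> \<in> unity_roots R n \<Longrightarrow> T (pt_gen R p (\<tau> (\<zeta> \<odot>\<^bsub>V\<^esub> v))) = \<zeta> \<odot>\<^bsub>V\<^esub> v"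
  shows "T (twisted_gen R n V A p \<tau> v) = v"
proof -
  interpret V: vectorspace R V
    using T by (simp add: linear_map_def)
  have n: "0 < n"
    using assms(1) by (simp add: primitive_root_of_unity_def)
  note \<mu> = roots_of_unity[OF assms(1), folded unity_roots_def]
  have "(\<Oplus>\<^bsub>V\<^esub>\<zeta>\<in>unity_roots R n. inv \<zeta> \<odot>\<^bsub>V\<^esub> T (pt_gen R p (\<tau> (\<zeta> \<odot>\<^bsub>V\<^esub> v))))
      = (\<Oplus>\<^bsub>V\<^esub>\<zeta>\<in>unity_roots R n. v)"
  proof (rule V.finsum_cong'[OF refl])
    fix \<zeta> assume \<zeta>: "\<zeta> \<in> unity_roots R n"
    note i = inv_nonzero[OF unity_roots_carrier[OF \<zeta>] unity_roots_nonzero[OF n \<zeta>]]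
    show "inv \<zeta> \<odot>\<^bsub>V\<^esub> T (pt_gen R p (\<tau> (\<zeta> \<odot>\<^bsub>V\<^esub> v))) = v"
      using i v unity_roots_carrier[OF \<zeta>] by (simp add: T_gen[OF \<zeta>] V.smult_assoc1[symmetric])
  qed (use v in auto)
  also have "\<dots> = (\<Oplus>\<^bsub>V\<^esub>\<zeta>\<in>unity_roots R n. \<one> \<odot>\<^bsub>V\<^esub> v)"
    using v by simp
  also have "\<dots> = (\<Oplus>\<zeta>\<in>unity_roots R n. \<one>) \<odot>\<^bsub>V\<^esub> v"
    by (rule V.finsum_smult_r[symmetric]) (use v in auto)
  also have "(\<Oplus>\<zeta>\<in>unity_roots R n. \<one>) = [n] \<cdot> \<one>"
    using add.finprod_const[of \<one> "unity_roots R n"] \<mu> by simp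
  finally have sum: "(\<Oplus>\<^bsub>V\<^esub>\<zeta>\<in>unity_roots R n. inv \<zeta> \<odot>\<^bsub>V\<^esub> T (pt_gen R p (\<tau> (\<zeta> \<odot>\<^bsub>V\<^esub> v))))
      = [n] \<cdot> \<one> \<odot>\<^bsub>V\<^esub> v" .
  have "T (twisted_gen R n V A p \<tau> v) = inv ([n] \<cdot> \<one>) \<odot>\<^bsub>V\<^esub> ([n] \<cdot> \<one> \<odot>\<^bsub>V\<^esub> v)"
    unfolding sum[symmetric] by (rule linear_map_twisted_gen[where \<tau> = \<tau> and V = V and v = v, OF assms(1,2) T])
  then show ?thesis
    using v inv_nonzero[OF _ \<mu>(3)] by (simp add: V.smult_assoc1[symmetric])
qed

text \<open>The weights depend on \<zeta> alone and not on the vector or the space, so the two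
  averages agree term by term once the generators correspond. Used with v' the image of v under a
  morphism.\<close>

lemma twisted_gen_map:
  assumes "primitive_root_of_unity R n z"
    and "\<And>\<zeta>. \<zeta> \<in> unity_roots R n \<Longrightarrow> \<tau> (\<zeta> \<odot>\<^bsub>V\<^esub> v) \<in> A"
    and "\<And>\<zeta>. \<zeta> \<in> unity_roots R n \<Longrightarrow> \<tau> (\<zeta> \<odot>\<^bsub>V'\<^esub> v') \<in> A'"
    and T: "linear_map R (free_pt R A p) (free_pt R A' p') T"
    and T_gen: "\<And>\<zeta>. \<zeta> \<in> unity_roots R n \<Longrightarrow>
      T (pt_gen R p (\<tau> (\<zeta> \<odot>\<^bsub>V\<^esub> v))) = pt_gen R p' (\<tau> (\<zeta> \<odot>\<^bsub>V'\<^esub> v'))"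
  shows "T (twisted_gen R n V A p \<tau> v) = twisted_gen R n V' A' p' \<tau> v'"
proof -
  let ?E = "free_pt R A' p'"
  interpret E: vectorspace R ?E
    by (rule free_pt_vectorspace)
  have n: "0 < n"
    using assms(1) by (simp add: primitive_root_of_unity_def)
  have "(\<Oplus>\<^bsub>?E\<^esub>\<zeta>\<in>unity_roots R n. inv \<zeta> \<odot>\<^bsub>?E\<^esub> T (pt_gen R p (\<tau> (\<zeta> \<odot>\<^bsub>V\<^esub> v))))
      = (\<Oplus>\<^bsub>?E\<^esub>\<zeta>\<in>unity_roots R n. inv \<zeta> \<odot>\<^bsub>?E\<^esub> pt_gen R p' (\<tau> (\<zeta> \<odot>\<^bsub>V'\<^esub> v')))"
    by (rule E.finsum_cong'[OF refl twisted_gen_summand_closed[where \<tau> = \<tau> and V = V' and v = v', OF n assms(3)]])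
      (simp_all only: T_gen)
  then have "twisted_gen R n V' A' p' \<tau> v' = inv ([n] \<cdot> \<one>) \<odot>\<^bsub>?E\<^esub>
      (\<Oplus>\<^bsub>?E\<^esub>\<zeta>\<in>unity_roots R n. inv \<zeta> \<odot>\<^bsub>?E\<^esub> T (pt_gen R p (\<tau> (\<zeta> \<odot>\<^bsub>V\<^esub> v))))"
    by (simp only: twisted_gen_def)
  moreover have "T (twisted_gen R n V A p \<tau> v) = inv ([n] \<cdot> \<one>) \<odot>\<^bsub>?E\<^esub>
      (\<Oplus>\<^bsub>?E\<^esub>\<zeta>\<in>unity_roots R n. inv \<zeta> \<odot>\<^bsub>?E\<^esub> T (pt_gen R p (\<tau> (\<zeta> \<odot>\<^bsub>V\<^esub> v))))"
    by (rule linear_map_twisted_gen[where \<tau> = \<tau> and V = V and v = v, OF assms(1,2) T])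
  ultimately show ?thesis
    by (simp only:)
qed

text \<open>Every multiple of the zero vector names the base point, whose generator is zero. This
  covers morphisms that kill a basis vector.\<close>

lemma twisted_gen_zero:
  assumes "vectorspace R V" and "primitive_root_of_unity R n z" and "\<tau> \<zero>\<^bsub>V\<^esub> = p"
  shows "twisted_gen R n V A p \<tau> \<zero>\<^bsub>V\<^esub> = \<zero>\<^bsub>free_pt R A p\<^esub>"
proof -
  let ?E = "free_pt R A p"
  interpret V: vectorspace R V by fact
  interpret E: vectorspace R ?E
    by (rule free_pt_vectorspace)
  have n: "0 < n"
    using assms(2) by (simp add: primitive_root_of_unity_def)
  have "(\<Oplus>\<^bsub>?E\<^esub>\<zeta>\<in>unity_roots R n. inv \<zeta> \<odot>\<^bsub>?E\<^esub> pt_gen R p (\<tau> (\<zeta> \<odot>\<^bsub>V\<^esub> \<zero>\<^bsub>V\<^esub>)))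
      = (\<Oplus>\<^bsub>?E\<^esub>\<zeta>\<in>unity_roots R n. \<zero>\<^bsub>?E\<^esub>)"
  proof (rule E.finsum_cong'[OF refl])
    fix \<zeta> assume "\<zeta> \<in> unity_roots R n"
    then show "inv \<zeta> \<odot>\<^bsub>?E\<^esub> pt_gen R p (\<tau> (\<zeta> \<odot>\<^bsub>V\<^esub> \<zero>\<^bsub>V\<^esub>)) = \<zero>\<^bsub>?E\<^esub>"
      using unity_roots_carrier[OF unity_roots_inv[OF n]]
      by (simp add: unity_roots_carrier assms(3) pt_gen_pt)
  qed (use E.zero_closed in blast)
  also have "\<dots> = \<zero>\<^bsub>?E\<^esub>"
    by (rule E.finsum_zero)
  finally show ?thesis
    unfolding twisted_gen_def using inv_nonzero(1)[OF _ roots_of_unity(3)[OF assms(2)]]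
    by (simp del: free_pt_zero free_pt_smult)
qed

text \<open>Multiplication by \<zeta> permutes the roots of unity. Replacing \<xi> by \<xi> \<zeta>
  in the sum turns its weight into the inverse of \<xi> \<zeta>, and the factor \<zeta> in front
  restores the inverse of \<xi>.\<close>

lemma twisted_gen_smult:
  assumes "vectorspace R V" and "primitive_root_of_unity R n z" and v: "v \<in> carrier V"
    and A: "\<And>\<zeta>. \<zeta> \<in> unity_roots R n \<Longrightarrow> \<tau> (\<zeta> \<odot>\<^bsub>V\<^esub> v) \<in> A"
    and \<zeta>: "\<zeta> \<in> unity_roots R n"
  shows "twisted_gen R n V A p \<tau> (\<zeta> \<odot>\<^bsub>V\<^esub> v) = \<zeta> \<odot>\<^bsub>free_pt R A p\<^esub> twisted_gen R n V A p \<tau> v"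
proof -
  let ?E = "free_pt R A p" and ?\<mu> = "unity_roots R n"
  interpret V: vectorspace R V by fact
  interpret E: vectorspace R ?E
    by (rule free_pt_vectorspace)
  have n: "0 < n"
    using assms(2) by (simp add: primitive_root_of_unity_def)
  note c = unity_roots_carrier
  note i = inv_nonzero[OF c unity_roots_nonzero[OF n]]
  let ?h = "\<lambda>\<xi>. inv \<xi> \<odot>\<^bsub>?E\<^esub> pt_gen R p (\<tau> (\<xi> \<odot>\<^bsub>V\<^esub> v))"
  have h: "?h \<in> ?\<mu> \<rightarrow> carrier ?E"
    by (rule twisted_gen_summand_closed[where \<tau> = \<tau> and V = V and v = v, OF n A])
  have inj: "inj_on (\<lambda>\<xi>. \<xi> \<otimes> \<zeta>) ?\<mu>"
    by (rule inj_onI) (use \<zeta> c unity_roots_nonzero[OF n \<zeta>] m_rcancel in auto)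
  have img: "(\<lambda>\<xi>. \<xi> \<otimes> \<zeta>) ` ?\<mu> = ?\<mu>"
  proof
    show "?\<mu> \<subseteq> (\<lambda>\<xi>. \<xi> \<otimes> \<zeta>) ` ?\<mu>"
    proof
      fix \<xi> assume \<xi>: "\<xi> \<in> ?\<mu>"
      have "\<xi> = \<xi> \<otimes> inv \<zeta> \<otimes> \<zeta>"
        using c[OF \<xi>] c[OF \<zeta>] i[OF \<zeta> \<zeta>] by (simp add: m_assoc)
      moreover have "\<xi> \<otimes> inv \<zeta> \<in> ?\<mu>"
        by (rule unity_roots_mult[OF \<xi> unity_roots_inv[OF n \<zeta>]])
      ultimately show "\<xi> \<in> (\<lambda>\<xi>. \<xi> \<otimes> \<zeta>) ` ?\<mu>"
        by blast
    qed
  qed (use \<zeta> unity_roots_mult in auto)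
  have step: "\<zeta> \<odot>\<^bsub>?E\<^esub> ?h (\<xi> \<otimes> \<zeta>) = inv \<xi> \<odot>\<^bsub>?E\<^esub> pt_gen R p (\<tau> (\<xi> \<odot>\<^bsub>V\<^esub> (\<zeta> \<odot>\<^bsub>V\<^esub> v)))"
    if \<xi>: "\<xi> \<in> ?\<mu>" for \<xi>
  proof -
    have \<xi>\<zeta>: "\<xi> \<otimes> \<zeta> \<in> ?\<mu>"
      by (rule unity_roots_mult[OF \<xi> \<zeta>])
    have "inv \<xi> = inv \<xi> \<otimes> (\<xi> \<otimes> \<zeta> \<otimes> inv (\<xi> \<otimes> \<zeta>))"
      by (simp add: i(2)[OF \<xi>\<zeta> \<xi>\<zeta>] i(1)[OF \<xi> \<xi>])
    also have "\<dots> = inv \<xi> \<otimes> \<xi> \<otimes> (\<zeta> \<otimes> inv (\<xi> \<otimes> \<zeta>))"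
      using c[OF \<xi>] c[OF \<zeta>] i(1)[OF \<xi>\<zeta> \<xi>\<zeta>] i(1)[OF \<xi> \<xi>] by (simp add: m_assoc)
    also have "\<dots> = \<zeta> \<otimes> inv (\<xi> \<otimes> \<zeta>)"
      using c[OF \<zeta>] i(1)[OF \<xi>\<zeta> \<xi>\<zeta>] by (simp add: i(3)[OF \<xi> \<xi>])
    finally have "\<zeta> \<otimes> inv (\<xi> \<otimes> \<zeta>) = inv \<xi>" ..
    moreover have "pt_gen R p (\<tau> ((\<xi> \<otimes> \<zeta>) \<odot>\<^bsub>V\<^esub> v)) \<in> carrier ?E"
      by (rule pt_gen_closed[OF A[OF \<xi>\<zeta>]])
    ultimately show ?thesis
      using E.smult_assoc1[OF c[OF \<zeta>] i(1)[OF \<xi>\<zeta> \<xi>\<zeta>]] V.smult_assoc1[OF c[OF \<xi>] c[OF \<zeta>] v]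
      by (simp del: free_pt_smult)
  qed
  have "\<zeta> \<odot>\<^bsub>?E\<^esub> (\<Oplus>\<^bsub>?E\<^esub>\<xi>\<in>?\<mu>. ?h \<xi>) = \<zeta> \<odot>\<^bsub>?E\<^esub> (\<Oplus>\<^bsub>?E\<^esub>\<xi>\<in>?\<mu>. ?h (\<xi> \<otimes> \<zeta>))"
    using E.finsum_reindex[of ?h "\<lambda>\<xi>. \<xi> \<otimes> \<zeta>" ?\<mu>] inj h img by (simp del: free_pt_smult)
  also have "\<dots> = (\<Oplus>\<^bsub>?E\<^esub>\<xi>\<in>?\<mu>. \<zeta> \<odot>\<^bsub>?E\<^esub> ?h (\<xi> \<otimes> \<zeta>))"
    by (rule E.finsum_smult[OF c[OF \<zeta>]]) (use h unity_roots_mult \<zeta> in blast)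
  also have "\<dots> = (\<Oplus>\<^bsub>?E\<^esub>\<xi>\<in>?\<mu>. inv \<xi> \<odot>\<^bsub>?E\<^esub> pt_gen R p (\<tau> (\<xi> \<odot>\<^bsub>V\<^esub> (\<zeta> \<odot>\<^bsub>V\<^esub> v))))"
  proof (rule E.finsum_cong'[OF refl _ step])
    show "(\<lambda>\<xi>. inv \<xi> \<odot>\<^bsub>?E\<^esub> pt_gen R p (\<tau> (\<xi> \<odot>\<^bsub>V\<^esub> (\<zeta> \<odot>\<^bsub>V\<^esub> v)))) \<in> ?\<mu> \<rightarrow> carrier ?E"
    proof (rule twisted_gen_summand_closed[OF n])
      fix \<xi> assume \<xi>: "\<xi> \<in> ?\<mu>"
      show "\<tau> (\<xi> \<odot>\<^bsub>V\<^esub> (\<zeta> \<odot>\<^bsub>V\<^esub> v)) \<in> A"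
        using A[OF unity_roots_mult[OF \<xi> \<zeta>]] V.smult_assoc1[OF c[OF \<xi>] c[OF \<zeta>] v] by simp
    qed
  qed
  finally have *: "\<zeta> \<odot>\<^bsub>?E\<^esub> (\<Oplus>\<^bsub>?E\<^esub>\<xi>\<in>?\<mu>. ?h \<xi>)
    = (\<Oplus>\<^bsub>?E\<^esub>\<xi>\<in>?\<mu>. inv \<xi> \<odot>\<^bsub>?E\<^esub> pt_gen R p (\<tau> (\<xi> \<odot>\<^bsub>V\<^esub> (\<zeta> \<odot>\<^bsub>V\<^esub> v))))" .
  have N: "inv ([n] \<cdot> \<one>) \<in> carrier R"
    by (rule inv_nonzero(1)[OF _ roots_of_unity(3)[OF assms(2)]]) simp
  show ?thesis
    unfolding twisted_gen_def *[symmetric]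
    using E.smult_assoc1[OF N c[OF \<zeta>] E.finsum_closed[OF h]]
      E.smult_assoc1[OF c[OF \<zeta>] N E.finsum_closed[OF h]] m_comm[OF N c[OF \<zeta>]]
    by (simp del: free_pt_smult)
qed

end

section \<open>The additive image\<close>

theorem theorem5p1:
  fixes X :: "('o, 'a) cat" and F :: "('f, 'r) ring_scheme"
    and R :: "('o, 'a, 'f, 'v) linrep" and n :: nat and B :: "'o \<Rightarrow> 'v set"
  assumes "small_category X"
    and "field F"
    and "fd_vect_rep X F R"
    and "\<exists>z. primitive_root_of_unity F n z"
    and "\<forall>x\<in>Obj X. vectorspace.basis F (VS R x) (B x)"
    and "\<forall>f\<in>Arr X. \<forall>b\<in>B (Dom X f).
           (\<exists>b'\<in>B (Cod X f). \<exists>c\<in>carrier F.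
              (c [^]\<^bsub>F\<^esub> n = \<one>\<^bsub>F\<^esub> \<or> c = \<zero>\<^bsub>F\<^esub>) \<and> act R f b = c \<odot>\<^bsub>VS R (Cod X f)\<^esub> b')
           \<or> act R f b = \<zero>\<^bsub>VS R (Cod X f)\<^esub>"
  shows "R \<in> free_pt_additive_image X F"
proof -
  interpret X: small_category X by fact
  interpret F: field F by fact
  interpret R: fd_vect_rep X F R by fact
  obtain z where z: "primitive_root_of_unity F n z"
    using assms(4) by blast
  have n: "0 < n"
    using z by (simp add: primitive_root_of_unity_def)
  have vs: "vectorspace F (VS R x)" if "x \<in> Obj X" for x
    by (rule R.VS_vectorspace[OF that])
  have mod: "Module.module F (VS R x)" if "x \<in> Obj X" for x
    by (rule vectorspace.axioms(1)[OF vs[OF that]])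
  have basis: "vectorspace.basis F (VS R x) (B x)" if "x \<in> Obj X" for x
    using assms(5) that by blast
  have B: "B x \<subseteq> carrier (VS R x)" if "x \<in> Obj X" for x
    using basis[OF that] by (simp add: vectorspace.basis_def[OF vs[OF that]])
  \<comment> \<open>Linear independence bounds a basis by the dimension; the finiteness is what the
    extension of \<iota> from \<open>B x\<close> requires.\<close>
  have fin: "finite (B x)" if "x \<in> Obj X" for x
    using basis[OF that] vectorspace.fin_dim_li_fin[OF vs[OF that] R.VS_fin_dim[OF that]]
    by (simp add: vectorspace.basis_def[OF vs[OF that]])
  note act_zero = linear_map.T0_is_0[OF R.act_linear]
  note act_smult = linear_map.T_smult[OF R.act_linear]

  \<comment> \<open>The pointed subfunctor of root-of-unity multiples of basis vectors\<close>
  let ?\<mu> = "unity_roots F n"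
  \<comment> \<open>The elements are actual vectors, not formal pairs of a root and a basis vector,
    so the functor laws of \<open>S\<close> are inherited from \<open>R\<close>. Zero is adjoined as
    the base point, also where \<open>B x\<close> is empty.\<close>
  define A where "A x = insert \<zero>\<^bsub>VS R x\<^esub> {\<zeta> \<odot>\<^bsub>VS R x\<^esub> b |\<zeta> b. \<zeta> \<in> ?\<mu> \<and> b \<in> B x}" for x
  have A_carrier: "A x \<subseteq> carrier (VS R x)" if "x \<in> Obj X" for x
    using B[OF that] Module.module.smult_closed[OF mod[OF that] F.unity_roots_carrier]
      vectorspace.axioms(1)[OF vs[OF that]]
    by (auto simp: A_def Module.module_def abelian_group_def abelian_monoid.zero_closed)
  have A_smult: "\<zeta> \<odot>\<^bsub>VS R x\<^esub> v \<in> A x" if x: "x \<in> Obj X" and \<zeta>: "\<zeta> \<in> ?\<mu>" and v: "v \<in> A x" for x \<zeta> v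
  proof -
    interpret V: vectorspace F "VS R x"
      by (rule vs[OF x])
    consider "v = \<zero>\<^bsub>VS R x\<^esub>" | \<xi> b where "\<xi> \<in> ?\<mu>" "b \<in> B x" "v = \<xi> \<odot>\<^bsub>VS R x\<^esub> b"
      using v by (auto simp: A_def)
    then show ?thesis
    proof cases
      case 1
      then show ?thesis
        using \<zeta> by (simp add: A_def F.unity_roots_carrier)
    next
      case 2
      then have "\<zeta> \<odot>\<^bsub>VS R x\<^esub> v = (\<zeta> \<otimes>\<^bsub>F\<^esub> \<xi>) \<odot>\<^bsub>VS R x\<^esub> b"
        using B[OF x] \<zeta> by (simp add: V.smult_assoc1 F.unity_roots_carrier subset_iff)
      with 2 show ?thesis
        using F.unity_roots_mult[OF \<zeta>] by (auto simp: A_def)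
    qed
  qed
  have B_A: "b \<in> A x" if x: "x \<in> Obj X" and b: "b \<in> B x" for x b
  proof -
    have "\<one>\<^bsub>F\<^esub> \<odot>\<^bsub>VS R x\<^esub> b = b"
      using Module.module.smult_one[OF mod[OF x]] B[OF x] b by auto
    then show ?thesis
      using b by (auto simp: A_def unity_roots_def intro!: exI[of _ "\<one>\<^bsub>F\<^esub>"] exI[of _ b])
  qed
  have act_B: "act R f b \<in> A (Cod X f)" if f: "f \<in> Arr X" and b: "b \<in> B (Dom X f)" for f b
  proof -
    consider "act R f b = \<zero>\<^bsub>VS R (Cod X f)\<^esub>"
      | b' c where "b' \<in> B (Cod X f)" "c \<in> carrier F" "c [^]\<^bsub>F\<^esub> n = \<one>\<^bsub>F\<^esub> \<or> c = \<zero>\<^bsub>F\<^esub>"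
        "act R f b = c \<odot>\<^bsub>VS R (Cod X f)\<^esub> b'"
      using assms(6) f b by blast
    then show ?thesis
    proof cases
      case 1
      then show ?thesis
        by (simp add: A_def)
    next
      case 2
      then show ?thesis
        using B[OF X.Cod_Obj[OF f]] Module.module.smult_l_null[OF mod[OF X.Cod_Obj[OF f]]]
        by (auto simp: A_def unity_roots_def)
    qed
  qed
  \<comment> \<open>By linearity the root \<zeta> moves past the morphism, and \<open>A\<close> is
    closed under multiplication by roots of unity.\<close>
  have act_A: "act R f v \<in> A (Cod X f)" if f: "f \<in> Arr X" and v: "v \<in> A (Dom X f)" for f v
  proof -
    consider "v = \<zero>\<^bsub>VS R (Dom X f)\<^esub>"
      | \<zeta> b where "\<zeta> \<in> ?\<mu>" "b \<in> B (Dom X f)" "v = \<zeta> \<odot>\<^bsub>VS R (Dom X f)\<^esub> b"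
      using v by (auto simp: A_def)
    then show ?thesis
    proof cases
      case 1
      then show ?thesis
        by (simp add: A_def act_zero[OF f])
    next
      case 2
      then have "act R f v = \<zeta> \<odot>\<^bsub>VS R (Cod X f)\<^esub> act R f b"
        using act_smult[OF f F.unity_roots_carrier] B[OF X.Dom_Obj[OF f]] by auto
      with 2 show ?thesis
        using A_smult[OF X.Cod_Obj[OF f] _ act_B[OF f]] by simp
    qed
  qed

  \<comment> \<open>The first and last components only pad vectors to the type prescribed for pointed sets.\<close>
  define \<tau> :: "'v \<Rightarrow> 'a \<times> 'v \<times> nat" where "\<tau> v = (undefined, v, 0)" for v
  define \<sigma> :: "'a \<times> 'v \<times> nat \<Rightarrow> 'v" where "\<sigma> s = fst (snd s)" for s
  have \<sigma>\<tau> [simp]: "\<sigma> (\<tau> v) = v" for v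
    by (simp add: \<sigma>_def \<tau>_def)
  define S :: "('o, 'a, 'a \<times> 'v \<times> nat) ptrep" where
    "S = \<lparr>pset = \<lambda>x. \<tau> ` A x, pt = \<lambda>x. \<tau> \<zero>\<^bsub>VS R x\<^esub>, pmap = \<lambda>f s. \<tau> (act R f (\<sigma> s))\<rparr>"
  have S_simps [simp]: "pset S x = \<tau> ` A x" "pt S x = \<tau> \<zero>\<^bsub>VS R x\<^esub>"
    "pmap S f s = \<tau> (act R f (\<sigma> s))" for x f s
    by (simp_all add: S_def)
  have S: "pointed_rep X S"
  proof (rule pointed_rep.intro)
    show "pt S x \<in> pset S x" for x
      by (simp add: A_def)
    show "pmap S f s \<in> pset S (Cod X f)" if "f \<in> Arr X" "s \<in> pset S (Dom X f)" for f s
      using that by (auto intro: act_A)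
    show "pmap S f (pt S (Dom X f)) = pt S (Cod X f)" if "f \<in> Arr X" for f
      by (simp add: act_zero[OF that])
    show "pmap S (Id X x) s = s" if "x \<in> Obj X" "s \<in> pset S x" for x s
      using that A_carrier[OF that(1)] R.act_Id by auto
    show "pmap S (Comp X g f) s = pmap S g (pmap S f s)"
      if "f \<in> Arr X" "g \<in> Arr X" "Cod X f = Dom X g" "s \<in> pset S (Dom X f)" for f g s
      using that A_carrier[OF X.Dom_Obj[OF that(1)]] R.act_Comp[OF that(1-3)] by auto
  qed

  \<comment> \<open>The free representation on the pointed subfunctor\<close>
  let ?E = "free_pt_star X F S"
  let ?fr = "\<lambda>x. free_pt F (pset S x) (pt S x)"
  have VS_E: "VS ?E x = ?fr x" and act_E: "act ?E f = free_pt_map F (pt S (Cod X f)) (pmap S f)" for x f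
    by (simp_all add: free_pt_star_def)
  have E: "vect_rep X F ?E"
    by (rule F.free_pt_star_vect_rep[OF assms(1) S])
  have E_lin: "linear_map F (?fr (Dom X f)) (?fr (Cod X f)) (act ?E f)" if "f \<in> Arr X" for f
    using vect_rep.act_linear[OF E that] by (simp only: VS_E)
  have E_gen: "act ?E f (pt_gen F (pt S (Dom X f)) s) = pt_gen F (pt S (Cod X f)) (pmap S f s)"
    if "f \<in> Arr X" "s \<in> pset S (Dom X f)" for f s
    unfolding act_E
    by (rule F.free_pt_map_pt_gen[of _ "pset S (Dom X f)" "pset S (Cod X f)"])
      (use that pointed_rep.pmap_in[OF S] pointed_rep.pmap_pt[OF S] in blast)+

  \<comment> \<open>The natural section \<iota>\<close>
  let ?a = "\<lambda>x. twisted_gen F n (VS R x) (pset S x) (pt S x) \<tau>"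
  have \<tau>_A: "\<tau> (\<zeta> \<odot>\<^bsub>VS R x\<^esub> v) \<in> pset S x" if "x \<in> Obj X" "v \<in> A x" "\<zeta> \<in> ?\<mu>" for x v \<zeta>
    using A_smult[OF that(1,3,2)] by simp
  have a_closed: "?a x v \<in> carrier (?fr x)" if "x \<in> Obj X" "v \<in> A x" for x v
    by (rule F.twisted_gen_closed[where \<tau> = \<tau> and V = "VS R x" and v = v, OF z \<tau>_A[OF that]])
  have "\<exists>T. linear_map F (VS R x) (?fr x) T \<and> (\<forall>b\<in>B x. T b = ?a x b)" if x: "x \<in> Obj X" for x
    by (rule linear_map_extend_basis[OF vs[OF x] F.free_pt_vectorspace basis[OF x] fin[OF x]])
      (use a_closed[OF x B_A[OF x]] in blast)
  then obtain \<iota> where \<iota>: "\<And>x. x \<in> Obj X \<Longrightarrow> linear_map F (VS R x) (?fr x) (\<iota> x)"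
    and \<iota>_B: "\<And>x b. \<lbrakk>x \<in> Obj X; b \<in> B x\<rbrakk> \<Longrightarrow> \<iota> x b = ?a x b"
    by metis
  \<comment> \<open>\<iota> is prescribed on \<open>B x\<close> only, but a morphism takes a basis
    vector into \<open>A\<close>, not into a basis. The averaged formula must therefore be known on
    all of \<open>A x\<close>, which is where \<open>twisted_gen_smult\<close> is used.\<close>
  have \<iota>_A: "\<iota> x v = ?a x v" if x: "x \<in> Obj X" and v: "v \<in> A x" for x v
  proof -
    consider "v = \<zero>\<^bsub>VS R x\<^esub>" | \<zeta> b where "\<zeta> \<in> ?\<mu>" "b \<in> B x" "v = \<zeta> \<odot>\<^bsub>VS R x\<^esub> b"
      using v by (auto simp: A_def)
    then show ?thesis
    proof cases
      case 1
      have "?a x \<zero>\<^bsub>VS R x\<^esub> = \<zero>\<^bsub>?fr x\<^esub>"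
        by (rule F.twisted_gen_zero[OF vs[OF x] z]) simp
      with 1 show ?thesis
        using linear_map.T0_is_0[OF \<iota>[OF x]] by simp
    next
      case 2
      have b: "b \<in> carrier (VS R x)"
        using B[OF x] 2 by auto
      have "?a x v = \<zeta> \<odot>\<^bsub>?fr x\<^esub> ?a x b"
        unfolding 2(3) by (rule F.twisted_gen_smult[where \<tau> = \<tau> and V = "VS R x" and v = b, OF vs[OF x] z b \<tau>_A[OF x B_A[OF x 2(2)]] 2(1)])
      also have "\<dots> = \<iota> x v"
        unfolding 2(3) linear_map.T_smult[OF \<iota>[OF x] F.unity_roots_carrier[OF 2(1)] b]
        by (simp only: \<iota>_B[OF x 2(2)])
      finally show ?thesis ..
    qed
  qed
  have \<iota>_hom: "rep_hom X F R ?E \<iota>"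
    unfolding rep_hom_def
  proof (intro conjI ballI)
    show "linear_map F (VS R x) (VS ?E x) (\<iota> x)" if "x \<in> Obj X" for x
      unfolding VS_E by (rule \<iota>[OF that])
  next
    fix f v assume f: "f \<in> Arr X" and v: "v \<in> carrier (VS R (Dom X f))"
    note Df = X.Dom_Obj[OF f] and Cf = X.Cod_Obj[OF f]
    show "\<iota> (Cod X f) (act R f v) = act ?E f (\<iota> (Dom X f) v)"
    proof (rule linear_map_eq_on_basis[OF linear_map_comp[OF R.act_linear[OF f] \<iota>[OF Cf]]
          linear_map_comp[OF \<iota>[OF Df] E_lin[OF f]] basis[OF Df] _ v])
      fix b assume b: "b \<in> B (Dom X f)"
      \<comment> \<open>The action permutes no weights: it sends [\<zeta> b] to the generator of
        \<zeta> times the image of b. The right-hand side is \<iota> of that image by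
        \<open>\<iota>_A\<close>.\<close>
      have "act ?E f (?a (Dom X f) b) = ?a (Cod X f) (act R f b)"
      proof (rule F.twisted_gen_map[OF z _ _ E_lin[OF f]])
        fix \<zeta> assume \<zeta>: "\<zeta> \<in> ?\<mu>"
        show "\<tau> (\<zeta> \<odot>\<^bsub>VS R (Dom X f)\<^esub> b) \<in> pset S (Dom X f)"
          by (rule \<tau>_A[OF Df B_A[OF Df b] \<zeta>])
        show "\<tau> (\<zeta> \<odot>\<^bsub>VS R (Cod X f)\<^esub> act R f b) \<in> pset S (Cod X f)"
          by (rule \<tau>_A[OF Cf act_B[OF f b] \<zeta>])
        have "act R f (\<zeta> \<odot>\<^bsub>VS R (Dom X f)\<^esub> b) = \<zeta> \<odot>\<^bsub>VS R (Cod X f)\<^esub> act R f b"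
          using act_smult[OF f F.unity_roots_carrier[OF \<zeta>]] B[OF Df] b by auto
        then show "act ?E f (pt_gen F (pt S (Dom X f)) (\<tau> (\<zeta> \<odot>\<^bsub>VS R (Dom X f)\<^esub> b)))
            = pt_gen F (pt S (Cod X f)) (\<tau> (\<zeta> \<odot>\<^bsub>VS R (Cod X f)\<^esub> act R f b))"
          using E_gen[OF f \<tau>_A[OF Df B_A[OF Df b] \<zeta>]] by simp
      qed
      then show "\<iota> (Cod X f) (act R f b) = act ?E f (\<iota> (Dom X f) b)"
        by (simp only: \<iota>_B[OF Df b] \<iota>_A[OF Cf act_B[OF f b]])
    qed
  qed

  \<comment> \<open>The natural retraction \<pi>\<close>
  let ?\<pi> = "\<lambda>x. free_lift F (VS R x) \<sigma>"
  have \<sigma>: "\<sigma> \<in> pset S x \<rightarrow> carrier (VS R x)" if "x \<in> Obj X" for x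
    using A_carrier[OF that] by auto
  have \<pi>: "linear_map F (?fr x) (VS R x) (?\<pi> x)" if "x \<in> Obj X" for x
    by (rule F.free_lift_linear[OF vs[OF that] \<sigma>[OF that]])
  have \<pi>_gen: "?\<pi> x (pt_gen F (pt S x) s) = \<sigma> s" if "x \<in> Obj X" "s \<in> pset S x" for x s
    by (rule F.free_lift_gen[OF vs[OF that(1)] \<sigma>[OF that(1)] _ that(2)]) simp
  have \<pi>_hom: "rep_hom X F ?E R ?\<pi>"
    unfolding rep_hom_def
  proof (intro conjI ballI)
    show "linear_map F (VS ?E x) (VS R x) (?\<pi> x)" if "x \<in> Obj X" for x
      unfolding VS_E by (rule \<pi>[OF that])
  next
    fix f c assume f: "f \<in> Arr X" and c: "c \<in> carrier (VS ?E (Dom X f))"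
    note Df = X.Dom_Obj[OF f] and Cf = X.Cod_Obj[OF f]
    show "?\<pi> (Cod X f) (act ?E f c) = act R f (?\<pi> (Dom X f) c)"
    proof (rule F.free_pt_linear_eq[OF linear_map_comp[OF E_lin[OF f] \<pi>[OF Cf]]
          linear_map_comp[OF \<pi>[OF Df] R.act_linear[OF f]] _ c[unfolded VS_E]])
      fix s assume s: "s \<in> pset S (Dom X f)"
      \<comment> \<open>On a generator both routes give \<open>act R f (\<sigma> s)\<close>, since
        \<open>pmap\<close> is the action of \<open>R\<close> carried along \<tau> and \<sigma>
        undoes \<tau>.\<close>
      have "?\<pi> (Cod X f) (act ?E f (pt_gen F (pt S (Dom X f)) s)) = \<sigma> (pmap S f s)"
        unfolding E_gen[OF f s] by (rule \<pi>_gen[OF Cf pointed_rep.pmap_in[OF S f s]])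
      also have "\<dots> = act R f (?\<pi> (Dom X f) (pt_gen F (pt S (Dom X f)) s))"
        unfolding \<pi>_gen[OF Df s] by simp
      finally show "?\<pi> (Cod X f) (act ?E f (pt_gen F (pt S (Dom X f)) s))
          = act R f (?\<pi> (Dom X f) (pt_gen F (pt S (Dom X f)) s))" .
    qed
  qed

  have retract: "?\<pi> x (\<iota> x v) = v" if x: "x \<in> Obj X" and v: "v \<in> carrier (VS R x)" for x v
  proof (rule linear_map_eq_on_basis[OF linear_map_comp[OF \<iota>[OF x] \<pi>[OF x]]
        linear_map_id[OF vs[OF x]] basis[OF x] _ v])
    fix b assume b: "b \<in> B x"
    have "?\<pi> x (?a x b) = b"
    proof (rule F.twisted_gen_retract[where \<tau> = \<tau> and V = "VS R x" and v = b, OF z \<tau>_A[OF x B_A[OF x b]] \<pi>[OF x]])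
      show "b \<in> carrier (VS R x)"
        using B[OF x] b by auto
      show "?\<pi> x (pt_gen F (pt S x) (\<tau> (\<zeta> \<odot>\<^bsub>VS R x\<^esub> b))) = \<zeta> \<odot>\<^bsub>VS R x\<^esub> b" if "\<zeta> \<in> ?\<mu>" for \<zeta>
        using \<pi>_gen[OF x \<tau>_A[OF x B_A[OF x b] that]] by simp
    qed
    then show "?\<pi> x (\<iota> x b) = b"
      by (simp only: \<iota>_B[OF x b])
  qed
  have "direct_summand X F R ?E"
    by (rule retract_direct_summand[where \<iota> = \<iota> and \<pi> = ?\<pi>, OF assms(1) R.vect_rep_axioms E \<iota>_hom \<pi>_hom retract])
  moreover have "rep_iso X F ?E ?E"
    by (rule rep_iso_refl[OF E])
  moreover have "rep_iso X F R (rep_fin_direct_sum 1 (\<lambda>_. R))"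
    by (rule rep_iso_fin_direct_sum_one[OF assms(2) R.vect_rep_axioms])
  ultimately show ?thesis
    unfolding free_pt_additive_image_def additive_image_def
    using R.vect_rep_axioms S E
    \<comment> \<open>One summand suffices: \<open>R\<close> itself is the summand, and the free
      representation on \<open>S\<close> is the object it splits off from.\<close>
    by (intro CollectI conjI exI[of _ 1] exI[of _ "\<lambda>_. S"] exI[of _ "\<lambda>_. ?E"] exI[of _ "\<lambda>_. R"]) auto
qed

end
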